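(* Let $u\colon\mathbb R^2\to\mathbb R$ be a smooth subharmonic function, and let $g_0$ be the standard Euclidean metric on $\mathbb R^2$. The Riemannian metric $e^{-2u}g_0$ on $\mathbb R^2$ is complete if and only if $\alpha(u)\le 1$.
   Context: For a subharmonic function $u$ on $\mathbb R^2$ set $M(r,u):=\sup\{u(z):|z|=r\}$ and $\alpha(u):=\lim_{r\to\infty}\frac{M(r,u)}{\log r}$; this limit is known to exist in $[0,\infty]$. A smooth function $u$ is subharmonic if and only if $\Delta u\ge 0$, where $\Delta$ is the Euclidean Laplacian. *)

theory Defs
  imports "HOL-Analysis.Analysis"
begin

section \<open>Smooth functions\<close>

text \<open>
  \<open>C_k_function k f\<close> says that \<open>f\<close> is of class \<open>C\<^sup>k\<close> on the whole space: \<open>f\<close> is (Frechet)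
  differentiable and all its first order partial derivatives are of class \<open>C\<^sup>k\<^sup>-\<^sup>1\<close>.
\<close>

fun C_k_function :: "nat \<Rightarrow> ('a::euclidean_space \<Rightarrow> real) \<Rightarrow> bool" where
  "C_k_function 0 f \<longleftrightarrow> continuous_on UNIV f"
| "C_k_function (Suc k) f \<longleftrightarrow>
     (\<forall>x. f differentiable (at x)) \<and>
     (\<forall>b\<in>Basis. C_k_function k (\<lambda>x. frechet_derivative f (at x) b))"

definition smooth_function :: "('a::euclidean_space \<Rightarrow> real) \<Rightarrow> bool" where
  "smooth_function f \<longleftrightarrow> (\<forall>k. C_k_function k f)"

section \<open>Subharmonic functions on the plane\<close>

definition circle_point :: "real^2 \<Rightarrow> real \<Rightarrow> real \<Rightarrow> real^2" where
  "circle_point a r t = a + r *\<^sub>R vector [cos t, sin t]"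

text \<open>
  Upper semicontinuity together with the sub-mean value inequality on all circles. Only real-valued
  functions are considered. A subharmonic function on the plane that is not identically \<open>-\<infinity>\<close> is
  integrable over every circle, so the integrability clause is part of the usual notion; it
  is stated because \<open>integral\<close> has the default value 0 for non-integrable functions. (By upper
  semicontinuity the function is bounded above on circles, so here integrability in the sense of
  Henstock and Kurzweil is Lebesgue integrability.)
\<close>

definition subharmonic :: "(real^2 \<Rightarrow> real) \<Rightarrow> bool" where
  "subharmonic u \<longleftrightarrow>
     (\<forall>c. open {x. u x < c}) \<and>
     (\<forall>a. \<forall>r>0. (\<lambda>t. u (circle_point a r t)) integrable_on {0..2*pi} \<and>
        u a \<le> 1 / (2*pi) * integral {0..2*pi} (\<lambda>t. u (circle_point a r t)))"

definition circle_sup :: "real \<Rightarrow> (real^2 \<Rightarrow> real) \<Rightarrow> real" where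
  "circle_sup r u = (SUP z\<in>{z. norm z = r}. u z)"

text \<open>The order of logarithmic growth, an element of \<open>[0,\<infinity>]\<close>.\<close>

definition log_growth :: "(real^2 \<Rightarrow> real) \<Rightarrow> ereal" where
  "log_growth u = Lim at_top (\<lambda>r. ereal (circle_sup r u / ln r))"

section \<open>Riemannian metrics on a Euclidean space and their completeness\<close>

text \<open>
  A Riemannian metric assigns to a point \<open>x\<close> an inner product \<open>g x\<close> on the tangent space at \<open>x\<close>,
  which is identified with the space itself.
\<close>

type_synonym 'a riem_metric = "'a \<Rightarrow> 'a \<Rightarrow> 'a \<Rightarrow> real"

definition euclidean_riem_metric :: "'a::euclidean_space riem_metric" where
  "euclidean_riem_metric x v w = v \<bullet> w"

definition conformal_metric ::
    "('a::euclidean_space \<Rightarrow> real) \<Rightarrow> 'a riem_metric \<Rightarrow> 'a riem_metric" where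
  "conformal_metric f g x v w = f x * g x v w"

text \<open>
  The library notion \<open>valid_path\<close> (continuous, and \<open>C\<^sup>1\<close> away from finitely many parameters) does not
  bound the derivative near the exceptional parameters, so it admits curves of infinite length.
  For this reason the length is an extended nonnegative number, rather than a real-valued integral
  that would give such curves length 0.
\<close>

definition riem_length :: "'a::euclidean_space riem_metric \<Rightarrow> (real \<Rightarrow> 'a) \<Rightarrow> ennreal" where
  "riem_length g \<gamma> =
     (\<integral>\<^sup>+t\<in>{0..1}. ennreal (sqrt (g (\<gamma> t) (vector_derivative \<gamma> (at t)) (vector_derivative \<gamma> (at t))))
        \<partial>lborel)"

text \<open>For a continuous metric, the infimum is finite because line segments have finite length.\<close>

definition riem_dist :: "'a::euclidean_space riem_metric \<Rightarrow> 'a \<Rightarrow> 'a \<Rightarrow> real" where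
  "riem_dist g x y =
     enn2real (INF \<gamma>\<in>{\<gamma>. valid_path \<gamma> \<and> pathstart \<gamma> = x \<and> pathfinish \<gamma> = y}. riem_length g \<gamma>)"

text \<open>Completeness of the Riemannian distance (by Hopf--Rinow, the same as geodesic completeness).\<close>

definition riem_complete :: "'a::euclidean_space riem_metric \<Rightarrow> bool" where
  "riem_complete g \<longleftrightarrow> Metric_space.mcomplete UNIV (riem_dist g)"

end

theory Submission
  imports Defs
begin

text \<open>
  Write \<open>U\<close> for \<open>u\<close> as a function on the complex plane and \<open>M(r)\<close> for its maximum on the circle of
  radius \<open>r\<close>. The metric has the length element \<open>exp(-U) |dz|\<close> and the Gauss curvature
  \<open>exp(2 U) \<Delta>U \<ge> 0\<close>.

  Slow growth implies completeness. Since \<open>log |z|\<close> is harmonic, the maximum principle on annuli shows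
  that \<open>M(r)\<close> is a convex function of \<open>log r\<close> (\<open>three_circles\<close>, \<open>max_on_circle_log_convex\<close>). Hence
  \<open>(M(r) - M(1)) / log r\<close> increases to \<open>\<alpha>(u)\<close>; so the limit exists, and if it is at most 1 then
  \<open>U(z) \<le> C + log |z|\<close> for \<open>|z| \<ge> 1\<close>. The length element is then at least a constant times
  \<open>|dz| / |z|\<close>, the distance to 0 grows at least like \<open>log |z|\<close>, bounded sets for the distance are
  bounded in the plane (\<open>mcomplete_if_log_growth\<close>), and Cauchy sequences converge.

  Completeness implies slow growth. By the Hopf--Rinow argument, balls of a complete metric are bounded in
  the plane (\<open>mcomplete_imp_bounded_ball\<close>). So for large \<open>|w|\<close> the ball of radius 2 about \<open>w\<close> avoids the
  closed unit disc, and it lies in the region \<open>|z| > 1\<close> that carries the hyperbolic metric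
  \<open>|dz| / (|z| log |z|)\<close>. A metric of nonnegative curvature with a ball of radius 2 about \<open>w\<close> cannot be
  much smaller at \<open>w\<close> than a metric of curvature -1 (the Ahlfors--Schwarz--Yau lemma, \<open>discrete_ahlfors\<close>):
  \<open>exp(U(w)) \<le> 4 |w| log |w|\<close>. Therefore \<open>M(r) \<le> log r + log (log r) + log 4\<close> and \<open>\<alpha>(u) \<le> 1\<close>.

  The usual proof of that lemma maximises the logarithm of the density
  \<open>exp(U(z)) / (|z| log |z|)\<close> plus \<open>log (1 - \<rho>(z)\<^sup>2)\<close>, where \<open>\<rho>\<close> is the distance to \<open>w\<close>, and needs an
  upper bound for the Laplacian of \<open>\<rho>\<^sup>2\<close>, that is, minimising geodesics and their second variation.
  Here \<open>\<rho>\<^sup>2\<close> is replaced by the energy \<open>N \<Sum> exp(-2 U(z\<^sub>i)) |z\<^sub>i\<^sub>+\<^sub>1 - z\<^sub>i|\<^sup>2\<close> of a chain of \<open>N\<close> steps from \<open>w\<close>,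
  and the maximum is taken over all chains. This has three advantages. First, an energy below 1 forces every
  step to be short, so the chains stay in a compact set (\<open>chains_confined\<close>) and the maximum exists.

  Second, the comparison for the Laplacian becomes algebra. Move the vertices to \<open>z\<^sub>i + h X\<^sub>i\<close> with one
  complex parameter \<open>h\<close>. The logarithm of each summand is superharmonic in \<open>h\<close>: it is twice a value of \<open>-U\<close>
  plus twice the harmonic function \<open>log |z\<^sub>i\<^sub>+\<^sub>1 - z\<^sub>i + h (X\<^sub>i\<^sub>+\<^sub>1 - X\<^sub>i)|\<close>. For the logarithm of a sum the
  variance of the gradients enters with the wrong sign, but a recursion for \<open>X\<close> makes all these gradients equal
  at \<open>h = 0\<close>, and the variance vanishes (\<open>balanced_energy_jets\<close>).

  Third, the size of \<open>X\<^sub>N\<close> is controlled without solving a differential equation. The maximal chain is stationary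
  at its inner vertices, so the derivative of the energy along \<open>X\<close> only sees the last step
  (\<open>end_variation\<close>). Stationarity is a discrete geodesic equation, by which consecutive summands of the
  energy are almost equal (\<open>edge_change\<close>); so the last step is not much longer than the average one.
\<close>

section \<open>Lengths of paths\<close>

definition exp_metric :: "('a::euclidean_space \<Rightarrow> real) \<Rightarrow> 'a riem_metric" where
  "exp_metric u = conformal_metric (\<lambda>x. exp (- 2 * u x)) euclidean_riem_metric"

definition speed :: "('a::euclidean_space \<Rightarrow> real) \<Rightarrow> (real \<Rightarrow> 'a) \<Rightarrow> real \<Rightarrow> real" where
  "speed u \<gamma> t = exp (- u (\<gamma> t)) * norm (vector_derivative \<gamma> (at t))"

definition arc_length :: "('a::euclidean_space \<Rightarrow> real) \<Rightarrow> (real \<Rightarrow> 'a) \<Rightarrow> real set \<Rightarrow> ennreal" where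
  "arc_length u \<gamma> A = (\<integral>\<^sup>+t. ennreal (speed u \<gamma> t) * indicator A t \<partial>lborel)"

lemma speed_nonneg: "0 \<le> speed u \<gamma> t"
  by (simp add: speed_def)

lemma riem_length_eq_arc_length: "riem_length (exp_metric u) \<gamma> = arc_length u \<gamma> {0..1}"
proof -
  have "sqrt (exp (- 2 * c) * (v \<bullet> v)) = exp (- c) * norm v" for c :: real and v :: 'a
    by (simp add: real_sqrt_mult norm_eq_sqrt_inner exp_double[of "-c", simplified])
  then show ?thesis
    unfolding riem_length_def arc_length_def speed_def exp_metric_def conformal_metric_def euclidean_riem_metric_def
    by simp
qed

lemma valid_path_C1_off_finite:
  assumes "valid_path \<gamma>"
  obtains S where "finite S" "\<And>t. t \<in> {0..1} - S \<Longrightarrow> \<gamma> differentiable (at t)"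
    "continuous_on ({0..1} - S) (\<lambda>t. vector_derivative \<gamma> (at t))"
  using assms unfolding valid_path_def piecewise_C1_differentiable_on_def C1_differentiable_on_eq
  by blast

lemma valid_path_continuous_on: "valid_path \<gamma> \<Longrightarrow> continuous_on {0..1} \<gamma>"
  using valid_path_imp_path path_def by blast

text \<open>
  The derivative of a valid path is continuous off a finite set, which suffices for measurability.
\<close>

lemma speed_measurable:
  fixes u :: "'a::euclidean_space \<Rightarrow> real"
  assumes "valid_path \<gamma>" "continuous_on UNIV u" "A \<in> sets borel" "A \<subseteq> {0..1}"
  shows "(\<lambda>t. ennreal (speed u \<gamma> t) * indicator A t) \<in> borel_measurable borel"
proof -
  obtain S where S: "finite S" "continuous_on ({0..1} - S) (\<lambda>t. vector_derivative \<gamma> (at t))"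
    using valid_path_C1_off_finite[OF assms(1)] by metis
  have c: "continuous_on (A - S) (speed u \<gamma>)"
    unfolding speed_def
    by (intro continuous_intros continuous_on_compose2[OF assms(2)]
        continuous_on_subset[OF valid_path_continuous_on[OF assms(1)]] continuous_on_subset[OF S(2)])
      (use assms(4) in auto)
  have "A - S \<in> sets borel"
    using assms(3) S(1) by (simp add: finite_imp_closed borel_closed sets.Diff)
  note m = borel_measurable_continuous_on_indicator[OF this c]
  have 1: "(\<lambda>t. ennreal (indicator (A - S) t *\<^sub>R speed u \<gamma> t)) \<in> borel_measurable borel"
    by (rule measurable_compose[OF m measurable_ennreal])
  show ?thesis
    by (rule measurable_discrete_difference[OF 1, of S])
      (use S(1) in \<open>auto simp: countable_finite indicator_def\<close>)
qed

lemma arc_length_split: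
  fixes u :: "'a::euclidean_space \<Rightarrow> real"
  assumes "valid_path \<gamma>" "continuous_on UNIV u" "0 \<le> c" "c \<le> 1"
  shows "arc_length u \<gamma> {0..1} = arc_length u \<gamma> {0..c} + arc_length u \<gamma> {c..1}"
proof -
  have "arc_length u \<gamma> {0..1} = (\<integral>\<^sup>+t. ennreal (speed u \<gamma> t) * indicator {0..c} t 
         + ennreal (speed u \<gamma> t) * indicator {c..1} t \<partial>lborel)"
    unfolding arc_length_def
    by (rule nn_integral_cong_AE, rule AE_mp[OF AE_lborel_singleton[of c]])
      (use assms in \<open>auto simp: indicator_def\<close>)
  also have "\<dots> = arc_length u \<gamma> {0..c} + arc_length u \<gamma> {c..1}"
    unfolding arc_length_def
    by (rule nn_integral_add) (use assms in \<open>auto intro!: speed_measurable[simplified]\<close>)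
  finally show ?thesis .
qed

text \<open>
  The change of variables behind reversed, joined and restricted paths. The identity for \<open>\<sigma>\<close> is required
  only inside the interval, because a joined path is not affinely related to its parts near the junction.
\<close>

lemma arc_length_affine:
  fixes u :: "'a::euclidean_space \<Rightarrow> real"
  assumes \<gamma>: "valid_path \<gamma>" and u: "continuous_on UNIV u" and m: "m \<noteq> 0"
    and \<sigma>: "\<And>t. p < t \<Longrightarrow> t < q \<Longrightarrow> \<sigma> t = \<gamma> (c + m * t)"
    and I: "(\<lambda>t. c + m * t) ` {p..q} = I" "I \<subseteq> {0..1}" 
  shows "arc_length u \<sigma> {p..q} = arc_length u \<gamma> I"
proof -
  obtain S where S: "finite S" "\<And>t. t \<in> {0..1} - S \<Longrightarrow> \<gamma> differentiable (at t)"
    using valid_path_C1_off_finite[OF \<gamma>] by metis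
  define S' where "S' = (\<lambda>x. (x - c) / m) ` S \<union> {p,q}"
  have S': "finite S'" using S unfolding S'_def by auto
  have inS': "c + m * t \<in> S \<Longrightarrow> t \<in> S'" for t
    using m unfolding S'_def by (auto simp: image_iff intro!: bexI[of _ "c + m*t"])
  have "compact I"
    unfolding I(1)[symmetric] by (intro compact_continuous_image continuous_intros compact_Icc)
  then have Ib: "I \<in> sets borel" by (simp add: borel_compact)
  have sp: "speed u \<sigma> t = \<bar>m\<bar> * speed u \<gamma> (c + m * t)" if t: "p \<le> t" "t \<le> q" "t \<notin> S'" for t
  proof -
    have t': "p < t" "t < q" using t unfolding S'_def by auto
    have "c + m * t \<in> I" unfolding I(1)[symmetric] using t by auto
    then have "c + m * t \<in> {0..1} - S"
      using t inS' I(2) by auto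
    then have "(\<gamma> has_vector_derivative vector_derivative \<gamma> (at (c + m*t))) (at (c + m * t))"
      using S(2) vector_derivative_works by blast
    then have "((\<gamma> \<circ> (\<lambda>t. c + m * t)) has_vector_derivative m *\<^sub>R vector_derivative \<gamma> (at (c + m*t))) (at t)"
      by (intro vector_diff_chain_at) (auto intro!: derivative_eq_intros)
    then have "(\<sigma> has_vector_derivative m *\<^sub>R vector_derivative \<gamma> (at (c + m*t))) (at t)"
      by (rule has_vector_derivative_transform_within_open[where S="{p<..<q}"])
        (use t' \<sigma> in auto)
    then show ?thesis
      unfolding speed_def using \<sigma>[OF t'] by (simp add: vector_derivative_at)
  qed
  have ind: "indicator I (c + m * t) = (indicator {p..q} t :: ennreal)" for t
    using I(1) m by (auto simp: indicator_def)
  have "arc_length u \<gamma> I = \<bar>m\<bar> * (\<integral>\<^sup>+t. ennreal (speed u \<gamma> (c + m * t)) * indicator I (c + m * t) \<partial>lborel)"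
    unfolding arc_length_def
    by (rule nn_integral_real_affine[OF _ m]) (rule speed_measurable[OF \<gamma> u Ib I(2)])
  also have "\<dots> = (\<integral>\<^sup>+t. ennreal \<bar>m\<bar> * (ennreal (speed u \<gamma> (c + m * t)) * indicator I (c + m * t)) \<partial>lborel)"
  proof (rule nn_integral_cmult[symmetric])
    have "(\<lambda>t. c + m * t) \<in> borel_measurable lborel" by simp
    from measurable_compose[OF this, OF speed_measurable[OF \<gamma> u Ib I(2), folded measurable_lborel1]]
    show "(\<lambda>t. ennreal (speed u \<gamma> (c + m * t)) * indicator I (c + m * t)) \<in> borel_measurable lborel"
      by simp
  qed
  also have "\<dots> = arc_length u \<sigma> {p..q}"
    unfolding arc_length_def
  proof (rule nn_integral_cong_AE)
    have "AE t in lborel. t \<notin> S'"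
      using S' by (intro AE_not_in) (simp add: finite_imp_null_set_lborel)
    then show "AE t in lborel. ennreal \<bar>m\<bar> * (ennreal (speed u \<gamma> (c + m * t)) * indicator I (c + m * t))
       = ennreal (speed u \<sigma> t) * indicator {p..q} t"
      unfolding ind by eventually_elim (auto simp: sp ennreal_mult' speed_nonneg indicator_def)
  qed
  finally show ?thesis by simp
qed

lemma arc_length_subpath:
  fixes u :: "'a::euclidean_space \<Rightarrow> real"
  assumes "valid_path \<gamma>" "continuous_on UNIV u" "0 \<le> a" "a < b" "b \<le> 1"
  shows "arc_length u (subpath a b \<gamma>) {0..1} = arc_length u \<gamma> {a..b}"
proof (rule arc_length_affine[where m="b-a" and c=a])
  show "(\<lambda>t. a + (b - a) * t) ` {0..1} = {a..b}"
    using image_affinity_atLeastAtMost[of "b - a" a 0 1] assms by (simp add: add.commute)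
qed (use assms in \<open>auto simp: subpath_def add.commute\<close>)

lemma arc_length_reversepath:
  fixes u :: "'a::euclidean_space \<Rightarrow> real"
  assumes "valid_path \<gamma>" "continuous_on UNIV u"
  shows "arc_length u (reversepath \<gamma>) {0..1} = arc_length u \<gamma> {0..1}"
  by (rule arc_length_affine[where m="-1" and c=1])
    (use assms in \<open>auto simp: reversepath_def image_affinity_atLeastAtMost\<close>)

lemma arc_length_join:
  fixes u :: "'a::euclidean_space \<Rightarrow> real"
  assumes "valid_path \<gamma>1" "valid_path \<gamma>2" "pathfinish \<gamma>1 = pathstart \<gamma>2" "continuous_on UNIV u"
  shows "arc_length u (\<gamma>1 +++ \<gamma>2) {0..1} = arc_length u \<gamma>1 {0..1} + arc_length u \<gamma>2 {0..1}"
proof -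
  have "arc_length u (\<gamma>1 +++ \<gamma>2) {0..1/2} = arc_length u \<gamma>1 {0..1}"
    by (rule arc_length_affine[where m=2 and c=0])
      (use assms image_affinity_atLeastAtMost[of 2 0 0 "1/2::real"] in \<open>auto simp: joinpaths_def\<close>)
  moreover have "arc_length u (\<gamma>1 +++ \<gamma>2) {1/2..1} = arc_length u \<gamma>2 {0..1}"
    by (rule arc_length_affine[where m=2 and c="-1"])
      (use assms image_affinity_atLeastAtMost[of 2 "-1" "1/2" "1::real"] in \<open>auto simp: joinpaths_def\<close>)
  ultimately show ?thesis
    using arc_length_split[of "\<gamma>1 +++ \<gamma>2" u "1/2"] assms by (simp add: valid_path_join)
qed

text \<open>
  All lower bounds for distances come from this fact: a function whose gradient is at most \<open>exp(-u)\<close> changes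
  along a path by at most the length. The fundamental theorem of calculus holds with the finitely many
  exceptional parameters as long as the length is finite.
\<close>

lemma arc_length_ge_increment:
  fixes u F :: "'a::euclidean_space \<Rightarrow> real"
  assumes \<gamma>: "valid_path \<gamma>" and u: "continuous_on UNIV u"
    and F: "\<And>x. (F has_derivative F' x) (at x)"
    and bd: "\<And>x v. \<bar>F' x v\<bar> \<le> exp (- u x) * norm v"
  shows "ennreal (F (\<gamma> 1) - F (\<gamma> 0)) \<le> arc_length u \<gamma> {0..1}"
proof (cases "arc_length u \<gamma> {0..1} = \<infinity>")
  case False
  obtain S where S: "finite S" "\<And>t. t \<in> {0..1} - S \<Longrightarrow> \<gamma> differentiable (at t)"
    using valid_path_C1_off_finite[OF \<gamma>] by metis
  let ?d = "\<lambda>t. F' (\<gamma> t) (vector_derivative \<gamma> (at t))"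
  have contF: "continuous_on UNIV F"
    using F has_derivative_continuous_on[of UNIV F F'] by (simp add: has_derivative_at_withinI)
  have "(?d has_integral (F (\<gamma> 1) - F (\<gamma> 0))) {0..1}"
  proof (rule fundamental_theorem_of_calculus_interior_strong[OF S(1)])
    show "continuous_on {0..1} (\<lambda>t. F (\<gamma> t))"
      by (rule continuous_on_compose2[OF contF valid_path_continuous_on[OF \<gamma>]]) auto
    show "((\<lambda>t. F (\<gamma> t)) has_vector_derivative ?d t) (at t)" if "t \<in> {0<..<1} - S" for t
    proof -
      have "(\<gamma> has_vector_derivative vector_derivative \<gamma> (at t)) (at t)"
        using S(2)[of t] that vector_derivative_works by auto
      then show ?thesis
        by (rule vector_derivative_diff_chain_within[where S=UNIV, simplified, unfolded o_def])
          (rule F[THEN has_derivative_at_withinI])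
    qed
  qed simp
  moreover have sp: "((\<lambda>t. speed u \<gamma> t) has_integral enn2real (arc_length u \<gamma> {0..1})) {0..1}"
  proof -
    have eq: "(\<lambda>t. ennreal (indicator {0..1} t * speed u \<gamma> t)) = (\<lambda>t. ennreal (speed u \<gamma> t) * indicator {0..1} t)"
      by (auto simp: indicator_def)
    have m0: "(\<lambda>t. ennreal (indicator {0..1} t * speed u \<gamma> t)) \<in> borel_measurable borel"
      unfolding eq using speed_measurable[OF \<gamma> u, of "{0..1}"] by simp
    have m: "(\<lambda>t. indicator {0..1} t * speed u \<gamma> t) \<in> borel_measurable borel"
      using measurable_compose[OF m0, of enn2real borel] by (simp add: speed_nonneg)
    have "((\<lambda>t. indicator {0..1} t * speed u \<gamma> t) has_integral enn2real (arc_length u \<gamma> {0..1})) UNIV"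
    proof (rule nn_integral_has_integral[OF m])
      show "(\<integral>\<^sup>+t. ennreal (indicator {0..1} t * speed u \<gamma> t) \<partial>lborel) = ennreal (enn2real (arc_length u \<gamma> {0..1}))"
        using False unfolding eq arc_length_def[symmetric] by (simp add: less_top)
    qed (auto simp: speed_nonneg)
    moreover have "(\<lambda>t. indicator {0..1} t * speed u \<gamma> t) = (\<lambda>t. if t \<in> {0..1} then speed u \<gamma> t else 0)"
      by (auto simp: indicator_def)
    ultimately show ?thesis
      using has_integral_restrict_UNIV[of "{0..1}" "speed u \<gamma>"] by simp
  qed
  ultimately have "F (\<gamma> 1) - F (\<gamma> 0) \<le> enn2real (arc_length u \<gamma> {0..1})"
    by (rule has_integral_le) (use bd in \<open>force simp: speed_def abs_le_iff\<close>)
  then show ?thesis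
    using False by (metis ennreal_enn2real ennreal_leI infinity_ennreal_def less_top)
qed simp

section \<open>The distance of a conformal metric\<close>

locale continuous_weight =
  fixes u :: "'a::euclidean_space \<Rightarrow> real"
  assumes continuous: "continuous_on UNIV u"
begin

text \<open>
  The infimum before its conversion to a real number; the two agree because segments have finite length.
\<close>

definition path_inf :: "'a \<Rightarrow> 'a \<Rightarrow> ennreal" where
  "path_inf x y = (INF \<gamma>\<in>{\<gamma>. valid_path \<gamma> \<and> pathstart \<gamma> = x \<and> pathfinish \<gamma> = y}. arc_length u \<gamma> {0..1})"

definition d :: "'a \<Rightarrow> 'a \<Rightarrow> real" where
  "d = riem_dist (exp_metric u)"

lemma d_eq: "d x y = enn2real (path_inf x y)"
  by (simp add: d_def riem_dist_def path_inf_def riem_length_eq_arc_length)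

lemma path_inf_le_segment:
  assumes "0 \<le> M" "\<And>z. z \<in> closed_segment x y \<Longrightarrow> exp (- u z) \<le> M"
  shows "path_inf x y \<le> ennreal (M * dist x y)"
proof -
  have "path_inf x y \<le> arc_length u (linepath x y) {0..1}"
    unfolding path_inf_def by (rule INF_lower) auto
  also have "\<dots> \<le> (\<integral>\<^sup>+t. ennreal (M * dist x y) * indicator {0..1::real} t \<partial>lborel)"
    unfolding arc_length_def
  proof (rule nn_integral_mono, goal_cases)
    case (1 t)
    have "speed u (linepath x y) t \<le> M * dist x y" if "t \<in> {0..1}"
      unfolding speed_def dist_norm norm_minus_commute[of x]
      using assms(2)[OF linepath_in_path[OF that]] by (simp add: mult_right_mono)
    then show ?case
      by (auto simp: indicator_def ennreal_leI)
  qed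
  also have "\<dots> = ennreal (M * dist x y)"
    by (simp add: nn_integral_cmult)
  finally show ?thesis .
qed

lemma exp_bounded_on_compact:
  assumes "compact K"
  obtains M where "0 < M" "\<And>z. z \<in> K \<Longrightarrow> exp (- u z) \<le> M"
proof -
  have "compact ((\<lambda>z. exp (- u z)) ` K)"
    by (intro compact_continuous_image assms continuous_intros continuous_on_subset[OF continuous]) auto
  then obtain M where "0 < M" "\<forall>x\<in>(\<lambda>z. exp (- u z)) ` K. norm x \<le> M"
    using compact_imp_bounded bounded_pos by blast
  then show ?thesis using that by force
qed

lemma path_inf_finite: "path_inf x y < \<infinity>"
proof -
  obtain M where "0 < M" "\<And>z. z \<in> closed_segment x y \<Longrightarrow> exp (- u z) \<le> M"
    using exp_bounded_on_compact[OF compact_segment] by metis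
  then show ?thesis
    using path_inf_le_segment[of M x y] by (auto intro: le_less_trans)
qed

lemma ennreal_d: "ennreal (d x y) = path_inf x y"
  using path_inf_finite by (simp add: d_eq)

lemma d_nonneg: "0 \<le> d x y"
  by (simp add: d_eq)

lemma d_le_segment:
  assumes "0 \<le> M" "\<And>z. z \<in> closed_segment x y \<Longrightarrow> exp (- u z) \<le> M"
  shows "d x y \<le> M * dist x y"
  using path_inf_le_segment[OF assms] assms(1) unfolding ennreal_d[symmetric] by (simp add: ennreal_le_iff)

lemma d_le_arc_length:
  assumes "valid_path \<gamma>"
  shows "ennreal (d (pathstart \<gamma>) (pathfinish \<gamma>)) \<le> arc_length u \<gamma> {0..1}"
  unfolding ennreal_d path_inf_def by (rule INF_lower) (use assms in auto)

lemma almost_minimizing_path: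
  assumes "0 < \<epsilon>"
  obtains \<gamma> where "valid_path \<gamma>" "pathstart \<gamma> = x" "pathfinish \<gamma> = y" 
    "arc_length u \<gamma> {0..1} < ennreal (d x y + \<epsilon>)"
proof -
  have "path_inf x y < ennreal (d x y + \<epsilon>)"
    unfolding ennreal_d[symmetric] using assms d_nonneg by (simp add: ennreal_less_iff)
  then show ?thesis
    using that unfolding path_inf_def INF_less_iff by auto
qed

lemma d_triangle: "d x z \<le> d x y + d y z"
proof (rule field_le_epsilon)
  fix e :: real assume e: "0 < e"
  obtain \<gamma>1 where 1: "valid_path \<gamma>1" "pathstart \<gamma>1 = x" "pathfinish \<gamma>1 = y" 
    "arc_length u \<gamma>1 {0..1} < ennreal (d x y + e/2)" using almost_minimizing_path[of "e/2"] e by auto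
  obtain \<gamma>2 where 2: "valid_path \<gamma>2" "pathstart \<gamma>2 = y" "pathfinish \<gamma>2 = z" 
    "arc_length u \<gamma>2 {0..1} < ennreal (d y z + e/2)" using almost_minimizing_path[of "e/2"] e by auto
  have "ennreal (d x z) \<le> arc_length u (\<gamma>1 +++ \<gamma>2) {0..1}"
    using d_le_arc_length[of "\<gamma>1 +++ \<gamma>2"] 1 2 by (simp add: valid_path_join)
  also have "\<dots> = arc_length u \<gamma>1 {0..1} + arc_length u \<gamma>2 {0..1}"
    using 1 2 continuous by (simp add: arc_length_join)
  also have "\<dots> \<le> ennreal (d x y + e/2) + ennreal (d y z + e/2)"
    using 1 2 by (simp add: add_mono less_imp_le)
  also have "\<dots> = ennreal (d x y + d y z + e)"
    using e d_nonneg by (simp flip: ennreal_plus)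
  finally show "d x z \<le> d x y + d y z + e"
    using e d_nonneg by (simp add: ennreal_le_iff add_nonneg_nonneg del: ennreal_plus)
qed

lemma d_commute: "d x y = d y x"
proof -
  have "d x y \<le> d y x" for x y
  proof (rule field_le_epsilon)
    fix e :: real assume e: "0 < e"
    obtain \<gamma> where 1: "valid_path \<gamma>" "pathstart \<gamma> = y" "pathfinish \<gamma> = x" 
      "arc_length u \<gamma> {0..1} < ennreal (d y x + e)" using almost_minimizing_path[of "e"] e by auto
    have "ennreal (d x y) \<le> arc_length u (reversepath \<gamma>) {0..1}"
      using d_le_arc_length[of "reversepath \<gamma>"] 1 by simp
    also have "\<dots> < ennreal (d y x + e)"
      using 1 continuous by (simp add: arc_length_reversepath)
    finally show "d x y \<le> d y x + e" using d_nonneg e by (simp add: ennreal_less_iff del: ennreal_plus)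
  qed
  then show ?thesis by (simp add: antisym)
qed

lemma d_refl [simp]: "d x x = 0"
  using d_le_segment[of "exp (- u x)" x x] d_nonneg[of x x] by simp

lemma d_ge_increment:
  assumes "\<And>x. (F has_derivative F' x) (at x)" "\<And>x v. \<bar>F' x v\<bar> \<le> exp (- u x) * norm v"
  shows "F y - F x \<le> d x y"
proof (rule field_le_epsilon)
  fix e :: real assume e: "0 < e"
  obtain \<gamma> where 1: "valid_path \<gamma>" "pathstart \<gamma> = x" "pathfinish \<gamma> = y" 
    "arc_length u \<gamma> {0..1} < ennreal (d x y + e)" using almost_minimizing_path[of "e"] e by auto
  have "ennreal (F y - F x) < ennreal (d x y + e)"
    using arc_length_ge_increment[OF 1(1) continuous assms] 1 by (simp add: pathstart_def pathfinish_def)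
  then show "F y - F x \<le> d x y + e" using d_nonneg[of x y] e
    by (cases "F y - F x \<ge> 0") (auto simp: ennreal_less_iff simp del: ennreal_plus)
qed

text \<open>
  The distance separates points and its small balls are small in the Euclidean sense. The test function is
  \<open>k (1 - max(0, 1 - |y - x|\<^sup>2 / r\<^sup>2)\<^sup>2)\<close>: it is of class C1, vanishes at \<open>x\<close>, equals \<open>k\<close> off the ball, and
  its gradient is supported in the ball, where \<open>exp(-u)\<close> is bounded below.
\<close>

lemma d_ge_outside_ball:
  assumes "0 < r"
  obtains k where "0 < k" "\<And>y. r \<le> dist x y \<Longrightarrow> k \<le> d x y"
proof -
  interpret neg: continuous_weight "\<lambda>x. - u x" 
    by unfold_locales (intro continuous_intros continuous)
  obtain M where M: "0 < M" "\<And>z. z \<in> cball x r \<Longrightarrow> exp (u z) \<le> M"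
    using neg.exp_bounded_on_compact[OF compact_cball, of x r] by auto
  \<comment> \<open>the gradient of \<open>F\<close> is at most \<open>4 k / r\<close>, and \<open>exp(-u) \<ge> 1 / M\<close> in the ball\<close>
  define k where "k = r / (4 * M)"
  have k: "0 < k" using assms M by (simp add: k_def)
  define q where "q y = 1 - ((y - x) \<bullet> (y - x)) / r\<^sup>2" for y
  define F where "F y = k * (1 - (max 0 (q y))\<^sup>2)" for y
  define F' where "F' y v = k * (2 * max 0 (q y) * (2 * ((y - x) \<bullet> v) / r\<^sup>2))" for y v
  have sq: "((\<lambda>t::real. (max 0 t)\<^sup>2) has_field_derivative 2 * max 0 t) (at t)" for t
  proof -
    consider "t > 0" | "t < 0" | "t = 0" by linarith
    then show ?thesis
    proof cases
      case 1
      have "((\<lambda>t::real. t\<^sup>2) has_field_derivative 2 * max 0 t) (at t)"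
        using 1 by (auto intro!: derivative_eq_intros)
      then show ?thesis
        by (rule has_field_derivative_transform_within_open[where S="{0<..}"]) (use 1 in auto)
    next
      case 2
      have "((\<lambda>t::real. 0) has_field_derivative 2 * max 0 t) (at t)"
        using 2 by (auto intro!: derivative_eq_intros)
      then show ?thesis
        by (rule has_field_derivative_transform_within_open[where S="{..<0}"]) (use 2 in auto)
    next
      case 3
      have "((\<lambda>h::real. max 0 h) \<longlongrightarrow> max 0 0) (at 0)"
        by (intro tendsto_intros)
      moreover have "\<forall>\<^sub>F h::real in at 0. max 0 h = (max 0 h)\<^sup>2 / h"
        by (auto simp: eventually_at_filter max_def power2_eq_square)
      ultimately show ?thesis
        unfolding 3 has_field_derivative_iff by (simp add: tendsto_cong)
    qed
  qed
  have der: "(F has_derivative F' y) (at y)" for y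
  proof -
    have q: "(q has_derivative (\<lambda>v. - (2 * ((y - x) \<bullet> v) / r\<^sup>2))) (at y)"
      unfolding q_def using assms by (auto intro!: derivative_eq_intros simp: inner_commute fun_eq_iff power2_eq_square field_simps)
    have "((\<lambda>y. (max 0 (q y))\<^sup>2) has_derivative (\<lambda>v. 2 * max 0 (q y) * (- (2 * ((y - x) \<bullet> v) / r\<^sup>2)))) (at y)"
      using has_derivative_compose[OF q sq[unfolded has_field_derivative_def]] by simp
    from has_derivative_mult_right[OF has_derivative_diff[OF has_derivative_const this], of k 1]
    show ?thesis unfolding F_def F'_def by simp
  qed
  have bd: "\<bar>F' y v\<bar> \<le> exp (- u y) * norm v" for y v
  proof (cases "dist x y < r")
    case True
    have q1: "0 \<le> max 0 (q y)" "max 0 (q y) \<le> 1" using assms by (auto simp: q_def)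
    have "\<bar>(y - x) \<bullet> v\<bar> \<le> norm (y - x) * norm v" by (rule Cauchy_Schwarz_ineq2)
    also have "\<dots> \<le> r * norm v" using True by (intro mult_right_mono) (auto simp: dist_norm norm_minus_commute)
    finally have "\<bar>(y - x) \<bullet> v\<bar> \<le> r * norm v" .
    then have "max 0 (q y) * \<bar>(y - x) \<bullet> v\<bar> \<le> 1 * (r * norm v)" 
      using q1 by (intro mult_mono) auto
    then have "\<bar>F' y v\<bar> \<le> 4 * k / r\<^sup>2 * (r * norm v)"
      unfolding F'_def using k assms q1 by (simp add: abs_mult field_simps)
    also have "\<dots> = 1 / M * norm v" using assms M by (simp add: k_def field_simps power2_eq_square)
    also have "1 / M \<le> exp (- u y)"
      using M(2)[of y] M(1) True by (simp add: exp_minus field_simps)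
    finally show ?thesis by (simp add: mult_right_mono)
  next
    case False
    then have "r\<^sup>2 \<le> (dist x y)\<^sup>2" using assms by (intro power_mono) auto
    then have "max 0 (q y) = 0"
      using assms by (simp add: q_def dist_norm power2_norm_eq_inner norm_minus_commute[of x])
    then show ?thesis by (simp add: F'_def)
  qed
  have "k \<le> d x y" if "r \<le> dist x y" for y
  proof -
    have "r\<^sup>2 \<le> (dist x y)\<^sup>2" using assms that by (intro power_mono) auto
    then have "max 0 (q y) = 0"
      using assms by (simp add: q_def dist_norm power2_norm_eq_inner norm_minus_commute[of x])
    then have "F y = k" by (simp add: F_def)
    moreover have "F x = 0" by (simp add: F_def q_def)
    ultimately show ?thesis using d_ge_increment[of F F' y x, OF der bd] by simp
  qed
  then show ?thesis using k that by blast
qed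

lemma d_eq_0_iff: "d x y = 0 \<longleftrightarrow> x = y"
proof
  assume 0: "d x y = 0"
  show "x = y"
  proof (rule ccontr)
    assume "x \<noteq> y"
    then obtain k where "0 < k" "k \<le> d x y" using d_ge_outside_ball[of "dist x y" x] by (metis order_refl zero_less_dist_iff)
    then show False using 0 by simp
  qed
qed simp

sublocale Metric_space UNIV d
  by unfold_locales (auto simp: d_nonneg d_commute d_eq_0_iff d_triangle)

lemma d_small_near:
  assumes "0 < \<epsilon>"
  obtains \<delta> where "0 < \<delta>" "\<And>y. dist x y < \<delta> \<Longrightarrow> d x y < \<epsilon>"
proof -
  obtain M where M: "0 < M" "\<And>z. z \<in> cball x 1 \<Longrightarrow> exp (- u z) \<le> M"
    using exp_bounded_on_compact[OF compact_cball] by metis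
  have "d x y < \<epsilon>" if "dist x y < min 1 (\<epsilon> / M)" for y
  proof -
    have "closed_segment x y \<subseteq> cball x 1"
      using that by (intro closed_segment_subset) auto
    then have "d x y \<le> M * dist x y" using M by (intro d_le_segment) auto
    then show ?thesis using that M(1) by (simp add: field_simps)
  qed
  then show ?thesis using that[of "min 1 (\<epsilon>/M)"] assms M(1) by simp
qed

lemma tendsto_d:
  assumes "(f \<longlongrightarrow> l) F"
  shows "((\<lambda>n. d x (f n)) \<longlongrightarrow> d x l) F"
proof (rule tendstoI)
  fix e :: real assume "0 < e"
  then obtain \<delta> where \<delta>: "0 < \<delta>" "\<And>y. dist l y < \<delta> \<Longrightarrow> d l y < e" using d_small_near by metis
  show "\<forall>\<^sub>F n in F. dist (d x (f n)) (d x l) < e"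
    using tendstoD[OF assms \<delta>(1)]
  proof eventually_elim
    case (elim n)
    then have "d l (f n) < e" using \<delta> by (simp add: dist_commute)
    then show ?case using d_triangle[of x l "f n"] d_triangle[of x "f n" l] d_commute[of l "f n"]
      by (simp add: dist_real_def abs_less_iff)
  qed
qed

lemma continuous_on_d: "continuous_on A f \<Longrightarrow> continuous_on A (\<lambda>t. d x (f t))"
  unfolding continuous_on_def by (auto intro: tendsto_d)

text \<open>
  The metric is a length metric: an almost minimising path is cut where its distance from \<open>x\<close> is \<open>t\<close>.
\<close>

lemma intermediate_point:
  assumes "0 \<le> t" "t \<le> d x y" "0 < \<epsilon>"
  obtains m where "d x m = t" "d m y \<le> d x y - t + \<epsilon>"
proof (cases "d x y = t")
  case True
  then show ?thesis using that[of y] assms by simp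
next
  case False
  show ?thesis
  proof (cases "t = 0")
    case True
    then show ?thesis using that[of x] assms by simp
  next
    case t0: False
    obtain \<gamma> where \<gamma>: "valid_path \<gamma>" "pathstart \<gamma> = x" "pathfinish \<gamma> = y" 
      "arc_length u \<gamma> {0..1} < ennreal (d x y + \<epsilon>)" using almost_minimizing_path assms(3) by metis
    have e: "\<gamma> 0 = x" "\<gamma> 1 = y" using \<gamma> by (auto simp: pathstart_def pathfinish_def)
    have "\<exists>c\<ge>0. c \<le> 1 \<and> d x (\<gamma> c) = t"
      by (rule IVT') (use e assms continuous_on_d[OF valid_path_continuous_on[OF \<gamma>(1)]] in auto)
    then obtain c where c: "0 \<le> c" "c \<le> 1" "d x (\<gamma> c) = t" by blast
    have c': "0 < c" "c < 1" using c e False t0 by (auto simp: less_le)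
    have 1: "ennreal (d x (\<gamma> c)) \<le> arc_length u \<gamma> {0..c}"
      using d_le_arc_length[OF valid_path_subpath[OF \<gamma>(1)], of 0 c] c c' e
        arc_length_subpath[OF \<gamma>(1) continuous, of 0 c] by (simp add: pathstart_def pathfinish_def subpath_def)
    have 2: "ennreal (d (\<gamma> c) y) \<le> arc_length u \<gamma> {c..1}"
      using d_le_arc_length[OF valid_path_subpath[OF \<gamma>(1)], of c 1] c c' e
        arc_length_subpath[OF \<gamma>(1) continuous, of c 1] by (simp add: pathstart_def pathfinish_def subpath_def)
    have "ennreal (d x (\<gamma> c) + d (\<gamma> c) y) \<le> arc_length u \<gamma> {0..c} + arc_length u \<gamma> {c..1}"
      using add_mono[OF 1 2] d_nonneg by simp
    also have "\<dots> = arc_length u \<gamma> {0..1}"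
      using arc_length_split[OF \<gamma>(1) continuous c(1,2)] by simp
    also have "\<dots> < ennreal (d x y + \<epsilon>)" by (rule \<gamma>)
    finally have "d x (\<gamma> c) + d (\<gamma> c) y < d x y + \<epsilon>"
      using d_nonneg assms(3) by (simp add: ennreal_less_iff del: ennreal_plus)
    then show ?thesis using that[of "\<gamma> c"] c by simp
  qed
qed

lemma closed_d_cball: "closed {y. d x y \<le> r}"
  using continuous_on_d[OF continuous_on_id, of UNIV x]
  by (intro closed_Collect_le) (auto simp: id_def)

text \<open>
  The step of the Hopf--Rinow argument. If the ball of radius \<open>r/2\<close> is bounded, it is compact. Points of the
  large ball that tend to infinity are reached through points of the small ball, which accumulate at some
  \<open>x'\<close>; from there the remaining distance is about \<open>r/2\<close>. The factor \<open>3/4\<close> leaves room for the errors.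
\<close>

lemma unbounded_ball_step:
  assumes "0 < r" "\<not> bounded {y. d x y \<le> r}"
  shows "\<exists>x'. d x x' \<le> r \<and> \<not> bounded {y. d x' y \<le> 3/4 * r}"
proof (cases "bounded {y. d x y \<le> r/2}")
  case False
  have "{y. d x y \<le> r/2} \<subseteq> {y. d x y \<le> 3/4 * r}" using assms(1) by auto
  then show ?thesis using False bounded_subset assms(1) by (intro exI[of _ x]) auto
next
  case True
  then have K: "compact {y. d x y \<le> r/2}"
    using closed_d_cball[of x "r/2"] unfolding compact_eq_bounded_closed by blast
  have "\<exists>y m. d x y \<le> r \<and> real n < norm y \<and> d x m \<le> r/2 \<and> d m y \<le> 5/8 * r" for n
  proof -
    obtain y where y: "d x y \<le> r" "real n < norm y"
      using assms(2) unfolding bounded_iff by (auto simp: not_le)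
    obtain m where "d x m = min (r/2) (d x y)" "d m y \<le> d x y - min (r/2) (d x y) + r/8"
      using intermediate_point[of "min (r/2) (d x y)" x y "r/8"] assms(1) d_nonneg by auto
    then show ?thesis using y assms(1) by (intro exI[of _ y] exI[of _ m]) (auto simp: min_def split: if_splits)
  qed
  then obtain y m where ym: "\<And>n. d x (y n) \<le> r" "\<And>n. real n < norm (y n)" "\<And>n. d x (m n) \<le> r/2"
      "\<And>n. d (m n) (y n) \<le> 5/8 * r" by metis
  obtain l \<rho> where l: "d x l \<le> r/2" "strict_mono \<rho>" "(m \<circ> \<rho>) \<longlonglongrightarrow> l"
    using K ym(3) unfolding compact_def by (metis mem_Collect_eq)
  have "(\<lambda>n. d l ((m \<circ> \<rho>) n)) \<longlonglongrightarrow> d l l" by (rule tendsto_d[OF l(3)])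
  then have "\<forall>\<^sub>F n in sequentially. d l ((m \<circ> \<rho>) n) < r/8"
    using assms(1) by (intro order_tendstoD(2)[where y="d l l"]) auto
  then obtain N where N: "\<And>n. n \<ge> N \<Longrightarrow> d l (m (\<rho> n)) < r/8"
    unfolding eventually_sequentially by auto
  have "\<not> bounded {y. d l y \<le> 3/4 * r}"
  proof
    assume "bounded {y. d l y \<le> 3/4 * r}"
    then obtain B where B: "\<And>z. d l z \<le> 3/4 * r \<Longrightarrow> norm z \<le> B" unfolding bounded_iff by auto
    define n where "n = max N (nat \<lceil>B\<rceil>)"
    have "d l (y (\<rho> n)) \<le> 3/4 * r"
      using N[of n] ym(4)[of "\<rho> n"] d_triangle[of l "y (\<rho> n)" "m (\<rho> n)"] by (simp add: n_def)
    then have "norm (y (\<rho> n)) \<le> B" by (rule B)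
    moreover have "B \<le> real n" unfolding n_def by linarith
    moreover have "real n \<le> real (\<rho> n)" using seq_suble[OF l(2)] by simp
    ultimately show False using ym(2)[of "\<rho> n"] by linarith
  qed
  then show ?thesis using l(1) assms(1) by (intro exI[of _ l]) auto
qed

text \<open>
  Iterating the previous step yields centres of unbounded balls with geometrically decreasing radii. These
  centres form a Cauchy sequence, but small balls about its limit are bounded.
\<close>

lemma mcomplete_imp_bounded_ball:
  assumes "mcomplete"
  shows "bounded {y. d x y \<le> r}"
proof (rule ccontr)
  assume nb: "\<not> bounded {y. d x y \<le> r}"
  then have nb': "\<not> bounded {y. d x y \<le> \<bar>r\<bar> + 1}"
    by (rule contrapos_nn) (auto elim!: bounded_subset)
  define q where "q n = (\<bar>r\<bar> + 1) * (3/4::real) ^ n" for n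
  have q0: "0 < q n" and qS: "q (Suc n) = 3/4 * q n" for n by (auto simp: q_def)
  have "\<exists>f. \<forall>n. \<not> bounded {y. d (f n) y \<le> q n} \<and> d (f n) (f (Suc n)) \<le> q n"
  proof (rule dependent_nat_choice)
    show "\<exists>x. \<not> bounded {y. d x y \<le> q 0}" using nb' by (auto simp: q_def)
    show "\<exists>y. \<not> bounded {z. d y z \<le> q (Suc n)} \<and> d x y \<le> q n" if "\<not> bounded {y. d x y \<le> q n}" for x n
      using unbounded_ball_step[OF q0 that] unfolding qS by blast
  qed
  then obtain f where f: "\<And>n. \<not> bounded {y. d (f n) y \<le> q n}" "\<And>n. d (f n) (f (Suc n)) \<le> q n" by blast
  \<comment> \<open>\<open>q n = 4 (q n - q (n + 1))\<close>, since the ratio is \<open>3/4\<close>\<close>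
  have tele: "d (f n) (f (n + p)) \<le> 4 * q n - 4 * q (n + p)" for n p
  proof (induction p)
    case (Suc p)
    then show ?case using d_triangle[of "f n" "f (n + Suc p)" "f (n + p)"] f(2)[of "n+p"] qS[of "n+p"] by simp
  qed simp
  have q_lim: "q \<longlonglongrightarrow> 0" unfolding q_def by (intro tendsto_mult_right_zero LIMSEQ_realpow_zero) auto
  have "MCauchy f"
    unfolding MCauchy_def
  proof (intro conjI allI impI)
    fix e :: real assume "0 < e"
    then have "\<forall>\<^sub>F n in sequentially. q n < e/4" using q_lim by (intro order_tendstoD(2)[of q 0]) auto
    then obtain N where N: "\<And>n. n \<ge> N \<Longrightarrow> q n < e/4" unfolding eventually_sequentially by auto
    have *: "d (f n) (f n') < e" if "N \<le> n" "n \<le> n'" for n n'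
      using tele[of n "n' - n"] N[of n] q0[of n'] that by simp
    show "\<exists>N. \<forall>n n'. N \<le> n \<longrightarrow> N \<le> n' \<longrightarrow> d (f n) (f n') < e"
      by (intro exI[of _ N] allI impI) (metis * d_commute nle_le)
  qed simp
  then obtain l where "limitin mtopology f l sequentially"
    using assms unfolding mcomplete_def by blast
  then have l: "\<And>e. 0 < e \<Longrightarrow> \<forall>\<^sub>F n in sequentially. d (f n) l < e" by (simp add: limitin_metric)
  obtain k where k: "0 < k" "\<And>y. 1 \<le> dist l y \<Longrightarrow> k \<le> d l y" using d_ge_outside_ball[of 1 l] by auto
  have "\<forall>\<^sub>F n in sequentially. d (f n) l < k/2 \<and> q n < k/2"
    using k q_lim by (intro eventually_conj l order_tendstoD(2)[of q 0]) auto
  then obtain n where n: "d (f n) l < k/2" "q n < k/2" unfolding eventually_sequentially by auto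
  have "{y. d (f n) y \<le> q n} \<subseteq> ball l 1"
  proof
    fix y assume "y \<in> {y. d (f n) y \<le> q n}"
    then have "d l y < k" using n d_triangle[of l y "f n"] d_commute[of l "f n"] by simp
    then show "y \<in> ball l 1" using k(2)[of y] by force
  qed
  then show False using f(1)[of n] bounded_subset[OF bounded_ball] by blast
qed

lemma mcomplete_if_bounded_balls:
  assumes bd: "\<And>r. bounded {y. d x y \<le> r}"
  shows "mcomplete"
  unfolding mcomplete_def
proof (intro allI impI)
  fix \<sigma> assume C: "MCauchy \<sigma>"
  then obtain N where N: "\<And>n. n \<ge> N \<Longrightarrow> d (\<sigma> N) (\<sigma> n) < 1"
    unfolding MCauchy_def by (meson less_numeral_extra(1) order_refl)
  define K where "K = {y. d x y \<le> d x (\<sigma> N) + 1}"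
  have "compact K" unfolding K_def using bd closed_d_cball by (simp add: compact_eq_bounded_closed)
  moreover have "\<sigma> (n + N) \<in> K" for n
    using N[of "n+N"] d_triangle[of x "\<sigma> (n+N)" "\<sigma> N"] unfolding K_def by simp
  ultimately obtain l \<rho> where l: "strict_mono \<rho>" "((\<lambda>n. \<sigma> (n + N)) \<circ> \<rho>) \<longlonglongrightarrow> l"
    unfolding compact_def by metis
  have "limitin mtopology (\<sigma> \<circ> (\<lambda>n. \<rho> n + N)) l sequentially"
    unfolding limitin_metric
  proof (intro conjI allI impI)
    fix e :: real assume "0 < e"
    then show "\<forall>\<^sub>F n in sequentially. (\<sigma> \<circ> (\<lambda>n. \<rho> n + N)) n \<in> UNIV \<and> d ((\<sigma> \<circ> (\<lambda>n. \<rho> n + N)) n) l < e"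
      using order_tendstoD(2)[OF tendsto_d[OF l(2), of l], of e] by (simp add: d_commute[of _ l])
  qed simp
  moreover have "strict_mono (\<lambda>n. \<rho> n + N)" using l(1) by (simp add: strict_mono_def)
  ultimately show "\<exists>l. limitin mtopology \<sigma> l sequentially"
    using MCauchy_convergent_subsequence[OF C] by blast
qed

text \<open>
  The function \<open>k/2 log (1 + |z|\<^sup>2)\<close> has gradient at most \<open>k / sqrt (1 + |z|\<^sup>2)\<close>, so it is 1-Lipschitz for the
  distance; it tends to infinity, and balls about 0 are bounded. Working with \<open>1 + |z|\<^sup>2\<close> instead of \<open>|z|\<close>
  avoids the singularity at 0.
\<close>

lemma mcomplete_if_log_growth:
  assumes "0 < k" "\<And>z. k / sqrt (1 + z \<bullet> z) \<le> exp (- u z)"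
  shows "mcomplete"
proof (rule mcomplete_if_bounded_balls)
  fix r
  define F where "F z = k / 2 * ln (1 + z \<bullet> z)" for z :: 'a
  define F' where "F' z v = k * ((z \<bullet> v) / (1 + z \<bullet> z))" for z v :: 'a
  have pos: "0 < 1 + z \<bullet> z" for z :: 'a by (simp add: add_pos_nonneg)
  have der: "(F has_derivative F' z) (at z)" for z
    unfolding F_def F'_def using pos[of z]
    by (auto intro!: derivative_eq_intros simp: fun_eq_iff inner_commute divide_simps)
  have bd: "\<bar>F' z v\<bar> \<le> exp (- u z) * norm v" for z v
  proof -
    have "\<bar>z \<bullet> v\<bar> \<le> norm z * norm v" by (rule Cauchy_Schwarz_ineq2)
    also have "norm z \<le> sqrt (1 + z \<bullet> z)" by (simp add: norm_eq_sqrt_inner)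
    finally have "\<bar>z \<bullet> v\<bar> \<le> sqrt (1 + z \<bullet> z) * norm v" by (simp add: mult_right_mono)
    then have "\<bar>F' z v\<bar> \<le> k * ((sqrt (1 + z \<bullet> z) * norm v) / (1 + z \<bullet> z))"
      unfolding F'_def using assms(1) pos[of z] by (simp add: abs_mult abs_divide divide_right_mono)
    also have "\<dots> = k / sqrt (1 + z \<bullet> z) * norm v"
      using pos[of z] real_sqrt_mult_self[of "1 + z \<bullet> z"] by (simp add: field_simps)
    also have "\<dots> \<le> exp (- u z) * norm v" by (intro mult_right_mono assms) simp
    finally show ?thesis .
  qed
  have "norm y \<le> exp (r / k)" if "d 0 y \<le> r" for y
  proof -
    have "F y - F 0 \<le> d 0 y" by (rule d_ge_increment[OF der bd])
    then have "ln (1 + y \<bullet> y) \<le> 2 * r / k" using that assms(1) by (simp add: F_def field_simps)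
    then have "exp (ln (1 + y \<bullet> y)) \<le> exp (2 * r / k)" by (simp only: exp_le_cancel_iff)
    then have "1 + y \<bullet> y \<le> exp (2 * r / k)" using pos[of y] by (simp only: exp_ln)
    moreover have "(exp (r / k))\<^sup>2 = exp (2 * r / k)" by (simp add: power2_eq_square flip: exp_add)
    ultimately have "(norm y)\<^sup>2 \<le> (exp (r / k))\<^sup>2" by (simp add: power2_norm_eq_inner)
    then show ?thesis by (rule power2_le_imp_le) simp
  qed
  then show "bounded {y. d 0 y \<le> r}" unfolding bounded_iff by blast
qed

text \<open>
  The energy bound makes each term smaller than \<open>1/N\<close>, so for large \<open>N\<close> a step that starts in the ball of
  radius 2 is so short that \<open>exp(-u)\<close> at most doubles along it. By the Cauchy--Schwarz inequality the sum of
  the terms \<open>exp(-u(z\<^sub>i)) |z\<^sub>i\<^sub>+\<^sub>1 - z\<^sub>i|\<close> is at most 1, so the distance from \<open>w\<close> never exceeds 2, and the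
  next step starts in the ball as well.
\<close>

lemma chains_confined:
  assumes bd: "\<And>r. bounded {y. d w y \<le> r}"
  obtains N0 where "\<And>N z i. N0 \<le> N \<Longrightarrow> z 0 = w \<Longrightarrow>
     real N * (\<Sum>i<N. exp (- 2 * u (z i)) * (dist (z i) (z (Suc i)))\<^sup>2) < 1 \<Longrightarrow> i \<le> N \<Longrightarrow> d w (z i) \<le> 2"
proof -
  obtain B where B: "\<And>y. d w y \<le> 2 \<Longrightarrow> norm y \<le> B" using bd[of 2] unfolding bounded_iff by auto
  have "uniformly_continuous_on (cball 0 (B + 1)) u"
    by (intro compact_uniformly_continuous continuous_on_subset[OF continuous]) auto
  then obtain \<eta> where \<eta>: "0 < \<eta>" "\<And>x y. x \<in> cball 0 (B + 1) \<Longrightarrow> y \<in> cball 0 (B + 1) \<Longrightarrow> dist x y < \<eta> \<Longrightarrow> dist (u x) (u y) < ln 2"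
    unfolding uniformly_continuous_on_def by (metis ln_gt_zero one_less_numeral_iff semiring_norm(76) dist_commute)
  interpret neg: continuous_weight "\<lambda>x. - u x" 
    by unfold_locales (intro continuous_intros continuous)
  obtain M where M: "0 < M" "\<And>z. z \<in> cball 0 (B + 1) \<Longrightarrow> exp (u z) \<le> M"
    using neg.exp_bounded_on_compact[OF compact_cball, of 0 "B+1"] by auto
  define \<eta>' where "\<eta>' = min 1 \<eta>"
  have \<eta>': "0 < \<eta>'" using \<eta> by (simp add: \<eta>'_def)
  obtain N0 :: nat where N0: "(M / \<eta>')\<^sup>2 < real N0" using reals_Archimedean2 by blast
  have "d w (z i) \<le> 2" if N: "N0 \<le> N" and z0: "z 0 = w" 
    and E: "real N * (\<Sum>i<N. exp (- 2 * u (z i)) * (dist (z i) (z (Suc i)))\<^sup>2) < 1" and i: "i \<le> N" for N z i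
  proof -
    define l where "l i = exp (- u (z i)) * dist (z i) (z (Suc i))" for i
    have l0: "0 \<le> l i" for i by (simp add: l_def)
    have l2: "(l i)\<^sup>2 = exp (- 2 * u (z i)) * (dist (z i) (z (Suc i)))\<^sup>2" for i
      by (simp add: l_def power_mult_distrib exp_double[of "- u (z i)", simplified])
    have E': "real N * (\<Sum>i<N. (l i)\<^sup>2) < 1" using E by (simp add: l2)
    have N_pos: "0 < real N" using N0 N zero_le_power2[of "M / \<eta>'"] by linarith
    have step: "dist (z i) (z (Suc i)) < \<eta>'" if "i < N" "d w (z i) \<le> 2" for i
    proof -
      have "real N * (l i)\<^sup>2 \<le> real N * (\<Sum>i<N. (l i)\<^sup>2)"
        using that by (intro mult_left_mono member_le_sum) auto
      then have "real N * (l i)\<^sup>2 < 1" using E' by (rule le_less_trans)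
      then have "(l i)\<^sup>2 < 1 / real N" using N_pos by (simp add: field_simps)
      have "dist (z i) (z (Suc i)) = exp (u (z i)) * l i" by (simp add: l_def exp_minus)
      also have "\<dots> \<le> M * l i" using B[OF that(2)] l0 by (intro mult_right_mono M) auto
      finally have "(dist (z i) (z (Suc i)))\<^sup>2 \<le> (M * l i)\<^sup>2" by (intro power_mono) auto
      also have "\<dots> < M\<^sup>2 * (1 / real N)" 
        using \<open>(l i)\<^sup>2 < 1 / real N\<close> M(1) by (simp only: power_mult_distrib) (intro mult_strict_left_mono, auto)
      also have "M\<^sup>2 * (1 / real N) < \<eta>'\<^sup>2"
      proof -
        have "(M / \<eta>')\<^sup>2 < real N" using N0 N by linarith
        then show ?thesis using \<eta>' N_pos by (simp add: power_divide field_simps)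
      qed
      finally show ?thesis using \<eta>' by (simp add: power2_less_imp_less)
    qed
    have seg: "d (z i) (z (Suc i)) \<le> 2 * l i" if "i < N" "d w (z i) \<le> 2" for i
    proof -
      have "exp (- u y) \<le> 2 * exp (- u (z i))" if y: "y \<in> closed_segment (z i) (z (Suc i))" for y
      proof -
        have dy: "dist (z i) y < \<eta>'"
          using step[OF \<open>i < N\<close> \<open>d w (z i) \<le> 2\<close>] dist_in_closed_segment[OF y] by (simp add: dist_commute)
        have "norm (z i) \<le> B" using B \<open>d w (z i) \<le> 2\<close> by simp
        moreover have "norm y \<le> norm (z i) + dist (z i) y" by norm
        ultimately have "dist (u (z i)) (u y) < ln 2" using dy \<eta>' by (intro \<eta>(2)) (auto simp: \<eta>'_def)
        then have "- u y \<le> ln 2 + - u (z i)" by (simp add: dist_real_def)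
        then have "exp (- u y) \<le> exp (ln 2 + - u (z i))" by (simp only: exp_le_cancel_iff)
        then show ?thesis by (simp only: exp_add exp_ln zero_less_numeral)
      qed
      then have "d (z i) (z (Suc i)) \<le> 2 * exp (- u (z i)) * dist (z i) (z (Suc i))"
        by (intro d_le_segment) auto
      then show ?thesis by (simp add: l_def)
    qed
    have "d w (z k) \<le> 2 * (\<Sum>i<k. l i) \<and> d w (z k) \<le> 2" if "k \<le> N" for k
      using that
    proof (induction k)
      case 0 then show ?case by (simp add: z0)
    next
      case (Suc k)
      then have IH: "d w (z k) \<le> 2 * (\<Sum>i<k. l i)" "d w (z k) \<le> 2" "k < N" by auto
      have 1: "d w (z (Suc k)) \<le> 2 * (\<Sum>i<Suc k. l i)"
        using IH(1) seg[OF IH(3,2)] d_triangle[of w "z (Suc k)" "z k"] by simp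
      have "(\<Sum>i<Suc k. l i)\<^sup>2 \<le> (\<Sum>i<N. l i)\<^sup>2"
        using Suc(2) l0 by (intro power_mono sum_mono2 sum_nonneg) auto
      also have "\<dots> \<le> (\<Sum>i<N. (l i)\<^sup>2) * (\<Sum>i<N. 1\<^sup>2)"
        using Cauchy_Schwarz_ineq_sum[of l "\<lambda>_. 1" "{..<N}"] by simp
      also have "\<dots> \<le> 1\<^sup>2" using E' by (simp add: mult.commute)
      finally have "(\<Sum>i<Suc k. l i) \<le> 1" by (rule power2_le_imp_le) simp
      then show ?case using 1 by simp
    qed
    then show ?thesis using i by blast
  qed
  then show ?thesis using that by blast
qed

end


section \<open>Second order jets at a local maximum\<close>

text \<open>
  Laplacians are computed below as sums of second derivatives along the lines in the directions \<open>X\<close> and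
  \<open>\<i> X\<close>. All arguments with the maximum principle, in the plane as well as for chains, thus concern the first
  two derivatives at 0 of functions of one real variable.
\<close>

definition jet2 :: "(real \<Rightarrow> real) \<Rightarrow> real \<Rightarrow> real \<Rightarrow> bool" where
  "jet2 f a b \<longleftrightarrow> (\<exists>f'. (\<forall>\<^sub>F t in nhds 0. (f has_field_derivative f' t) (at t)) \<and> f' 0 = a \<and>
     (f' has_field_derivative b) (at 0))"

lemma jet2I:
  assumes "\<forall>\<^sub>F t in nhds 0. (f has_field_derivative f' t) (at t)" "(f' has_field_derivative b) (at 0)" "f' 0 = a"
  shows "jet2 f a b"
  using assms unfolding jet2_def by blast

lemma jet2_cong: "jet2 f a b \<Longrightarrow> a = a' \<Longrightarrow> b = b' \<Longrightarrow> jet2 f a' b'"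
  by simp

lemma jet2_imp_deriv: "jet2 f a b \<Longrightarrow> (f has_field_derivative a) (at 0)"
  unfolding jet2_def using eventually_nhds_x_imp_x by blast

lemma jet2_imp_cont: "jet2 f a b \<Longrightarrow> isCont f 0"
  using jet2_imp_deriv DERIV_isCont by blast

lemma jet2_const: "jet2 (\<lambda>_. c) 0 0"
  by (rule jet2I[where f'="\<lambda>_. 0"]) auto

lemma jet2_quadratic: "jet2 (\<lambda>t. A + t * B + t\<^sup>2 * C) B (2 * C)"
  by (rule jet2I[where f'="\<lambda>t. B + 2 * t * C"]) (auto intro!: derivative_eq_intros always_eventually)

lemma jet2_add:
  assumes "jet2 f a b" "jet2 g c d"
  shows "jet2 (\<lambda>t. f t + g t) (a + c) (b + d)"
proof -
  from assms obtain f' g' where f: "\<forall>\<^sub>F t in nhds 0. (f has_field_derivative f' t) (at t)" "f' 0 = a" "(f' has_field_derivative b) (at 0)"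
    and g: "\<forall>\<^sub>F t in nhds 0. (g has_field_derivative g' t) (at t)" "g' 0 = c" "(g' has_field_derivative d) (at 0)"
    unfolding jet2_def by blast
  show ?thesis
  proof (rule jet2I[where f'="\<lambda>t. f' t + g' t"])
    show "\<forall>\<^sub>F t in nhds 0. ((\<lambda>t. f t + g t) has_real_derivative f' t + g' t) (at t)"
      using f(1) g(1) by eventually_elim (auto intro!: derivative_eq_intros)
  qed (use f g in \<open>auto intro!: derivative_eq_intros\<close>)
qed

lemma jet2_sum:
  assumes "\<And>i. i \<in> I \<Longrightarrow> jet2 (f i) (a i) (b i)"
  shows "jet2 (\<lambda>t. \<Sum>i\<in>I. f i t) (\<Sum>i\<in>I. a i) (\<Sum>i\<in>I. b i)"
  using assms by (induction I rule: infinite_finite_induct) (auto intro!: jet2_add jet2_const)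

lemma jet2_mult:
  assumes "jet2 f a b" "jet2 g c d"
  shows "jet2 (\<lambda>t. f t * g t) (a * g 0 + f 0 * c) (b * g 0 + 2 * a * c + f 0 * d)"
proof -
  from assms obtain f' g' where f: "\<forall>\<^sub>F t in nhds 0. (f has_field_derivative f' t) (at t)" "f' 0 = a" "(f' has_field_derivative b) (at 0)"
    and g: "\<forall>\<^sub>F t in nhds 0. (g has_field_derivative g' t) (at t)" "g' 0 = c" "(g' has_field_derivative d) (at 0)"
    unfolding jet2_def by blast
  show ?thesis
  proof (rule jet2I[where f'="\<lambda>t. f' t * g t + f t * g' t"])
    show "\<forall>\<^sub>F t in nhds 0. ((\<lambda>t. f t * g t) has_real_derivative f' t * g t + f t * g' t) (at t)"
      using f(1) g(1) by eventually_elim (auto intro!: derivative_eq_intros)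
    show "((\<lambda>t. f' t * g t + f t * g' t) has_real_derivative b * g 0 + 2 * a * c + f 0 * d) (at 0)"
      using f(2,3) g(2,3) jet2_imp_deriv[OF assms(1)] jet2_imp_deriv[OF assms(2)]
      by (auto intro!: derivative_eq_intros)
  qed (use f g in auto)
qed

lemma jet2_cmult:
  assumes "jet2 f a b"
  shows "jet2 (\<lambda>t. c * f t) (c * a) (c * b)"
  using jet2_mult[OF jet2_const[of c] assms] by simp

lemma jet2_compose:
  assumes f: "jet2 f a b" and \<phi>: "\<forall>\<^sub>F y in nhds (f 0). (\<phi> has_field_derivative \<phi>' y) (at y)"
    "(\<phi>' has_field_derivative c) (at (f 0))"
  shows "jet2 (\<lambda>t. \<phi> (f t)) (\<phi>' (f 0) * a) (c * a\<^sup>2 + \<phi>' (f 0) * b)"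
proof -
  from f obtain f' where f': "\<forall>\<^sub>F t in nhds 0. (f has_field_derivative f' t) (at t)" "f' 0 = a" "(f' has_field_derivative b) (at 0)"
    unfolding jet2_def by blast
  have "filterlim f (nhds (f 0)) (nhds 0)"
    using jet2_imp_cont[OF f] by (simp add: isCont_def tendsto_at_iff_tendsto_nhds)
  then have ev: "\<forall>\<^sub>F t in nhds 0. (\<phi> has_field_derivative \<phi>' (f t)) (at (f t))"
    using \<phi>(1) by (rule eventually_compose_filterlim[rotated])
  show ?thesis
  proof (rule jet2I[where f'="\<lambda>t. \<phi>' (f t) * f' t"])
    show "\<forall>\<^sub>F t in nhds 0. ((\<lambda>t. \<phi> (f t)) has_real_derivative \<phi>' (f t) * f' t) (at t)"
      using ev f'(1) by eventually_elim (rule DERIV_chain2)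
    show "((\<lambda>t. \<phi>' (f t) * f' t) has_real_derivative c * a\<^sup>2 + \<phi>' (f 0) * b) (at 0)"
      using DERIV_mult[OF DERIV_chain2[OF \<phi>(2) jet2_imp_deriv[OF f]] f'(3)] f'(2)
      by (simp add: power2_eq_square mult_ac add_ac)
  qed (use f' in auto)
qed

lemma jet2_exp: "jet2 f a b \<Longrightarrow> jet2 (\<lambda>t. exp (f t)) (exp (f 0) * a) (exp (f 0) * (a\<^sup>2 + b))"
  by (rule jet2_cong[OF jet2_compose[where \<phi>'=exp and c="exp (f 0)"]])
    (auto intro!: derivative_eq_intros always_eventually simp: algebra_simps)

lemma jet2_ln: 
  assumes "jet2 f a b" "0 < f 0"
  shows "jet2 (\<lambda>t. ln (f t)) (a / f 0) (b / f 0 - (a / f 0)\<^sup>2)"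
proof (rule jet2_cong[OF jet2_compose[OF assms(1), where \<phi>'="\<lambda>y. 1 / y" and c="- (1 / (f 0)\<^sup>2)"]])
  have "\<forall>\<^sub>F y in nhds (f 0). 0 < y" using assms(2) eventually_nhds_in_open[of "{0<..}" "f 0"] by simp
  then show "\<forall>\<^sub>F y in nhds (f 0). (ln has_real_derivative 1 / y) (at y)"
    by eventually_elim (auto intro!: derivative_eq_intros)
qed (use assms in \<open>auto intro!: derivative_eq_intros simp: field_simps power2_eq_square\<close>)

lemma jet2_max:
  assumes f: "jet2 f a b" and max: "\<forall>\<^sub>F t in nhds 0. f t \<le> f 0"
  shows "a = 0" "b \<le> 0"
proof -
  from f obtain f' where f': "\<forall>\<^sub>F t in nhds 0. (f has_field_derivative f' t) (at t)" "f' 0 = a" "(f' has_field_derivative b) (at 0)"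
    unfolding jet2_def by blast
  obtain \<delta> where \<delta>: "0 < \<delta>" "\<And>t. \<bar>t\<bar> < \<delta> \<Longrightarrow> (f has_field_derivative f' t) (at t) \<and> f t \<le> f 0"
    using eventually_conj[OF f'(1) max] unfolding eventually_nhds_metric by (auto simp: dist_real_def)
  show a: "a = 0"
    by (rule DERIV_local_max[of f a 0 \<delta>]) (use \<delta> jet2_imp_deriv[OF f] in \<open>auto simp: abs_minus_commute\<close>)
  show "b \<le> 0"
  proof (rule ccontr)
    assume "\<not> b \<le> 0"
    then have "0 < b" by simp
    then obtain \<epsilon> where \<epsilon>: "0 < \<epsilon>" "\<And>h. 0 < h \<Longrightarrow> h < \<epsilon> \<Longrightarrow> f' 0 < f' (0 + h)"
      using DERIV_pos_inc_right[OF f'(3)] by blast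
    define s where "s = min \<delta> \<epsilon> / 2"
    have s: "0 < s" "s < \<delta>" "s < \<epsilon>" using \<delta> \<epsilon> by (auto simp: s_def)
    obtain x where x: "0 < x" "x < s" "f s - f 0 = (s - 0) * f' x"
      using MVT2[of 0 s f f'] s \<delta>(2) by force
    have "0 < f' x" using \<epsilon>(2)[of x] x s f'(2) a by simp
    then have "f 0 < f s" using x s by (metis diff_gt_0_iff_gt diff_zero mult_pos_pos)
    then show False using \<delta>(2)[of s] s by simp
  qed
qed

section \<open>Functions of class C2 and harmonicity of the logarithm\<close>

text \<open>
  \<open>G\<close> is the complex gradient \<open>U\<^sub>x - \<i> U\<^sub>y\<close>, so that the derivative of \<open>U\<close> in the direction \<open>h\<close> is
  \<open>Re (G h)\<close>. This form turns the balancing recursion for chains into an equation between complex numbers.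
\<close>

locale C2_plane =
  fixes U :: "complex \<Rightarrow> real" and G :: "complex \<Rightarrow> complex" and G' :: "complex \<Rightarrow> complex \<Rightarrow> complex"
  assumes U_deriv: "(U has_derivative (\<lambda>h. Re (G z * h))) (at z)"
    and G_deriv: "(G has_derivative G' z) (at z)"
    and G'_cont: "continuous_on UNIV (\<lambda>z. G' z 1)" "continuous_on UNIV (\<lambda>z. G' z \<i>)"
begin

definition laplacian :: "complex \<Rightarrow> real" where
  "laplacian z = Re (G' z 1) + Re (\<i> * G' z \<i>)"

lemma G'_eq: "G' z X = of_real (Re X) * G' z 1 + of_real (Im X) * G' z \<i>"
proof -
  interpret bounded_linear "G' z" using G_deriv has_derivative_bounded_linear by blast
  have "G' z X = G' z (Re X *\<^sub>R 1 + Im X *\<^sub>R \<i>)"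
    by (rule arg_cong[where f="G' z"]) (simp add: complex_eq_iff)
  also have "\<dots> = Re X *\<^sub>R G' z 1 + Im X *\<^sub>R G' z \<i>" by (simp only: add scaleR)
  finally show ?thesis by (simp add: scaleR_conv_of_real)
qed

text \<open>
  The mixed second derivatives cancel between the directions \<open>X\<close> and \<open>\<i> X\<close>.
\<close>

lemma laplacian_rotate: "Re (G' z X * X) + Re (G' z (\<i> * X) * (\<i> * X)) = (norm X)\<^sup>2 * laplacian z"
  unfolding laplacian_def G'_eq[of z X] G'_eq[of z "\<i> * X"] cmod_power2
  by (simp add: algebra_simps power2_eq_square)

lemma U_line: "((\<lambda>t. U (z + of_real t * X)) has_field_derivative Re (G (z + of_real t * X) * X)) (at t)"
proof -
  have "((\<lambda>t. z + of_real t * X) has_derivative (\<lambda>h. of_real h * X)) (at t)"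
    by (auto intro!: derivative_eq_intros)
  from has_derivative_compose[OF this U_deriv] show ?thesis
    unfolding has_field_derivative_def by (auto elim!: has_derivative_eq_rhs simp: fun_eq_iff algebra_simps)
qed

lemma G_line: "((\<lambda>t. Re (G (z + of_real t * X) * X)) has_field_derivative Re (G' (z + of_real t * X) X * X)) (at t)"
proof -
  have 1: "((\<lambda>t. z + of_real t * X) has_derivative (\<lambda>h. of_real h * X)) (at t)"
    by (auto intro!: derivative_eq_intros)
  have "((\<lambda>t. Re (G (z + of_real t * X) * X)) has_derivative (\<lambda>h. Re (G' (z + of_real t * X) (of_real h * X) * X))) (at t)"
    using has_derivative_Re[OF has_derivative_mult_left[OF has_derivative_compose[OF 1 G_deriv], of X]] by simp
  moreover have "G' w (of_real h * X) = of_real h * G' w X" for w h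
    using G'_eq[of w "of_real h * X"] G'_eq[of w X] by (simp add: algebra_simps)
  ultimately show ?thesis
    unfolding has_field_derivative_def by (auto elim!: has_derivative_eq_rhs simp: fun_eq_iff algebra_simps)
qed

lemma jet2_U: "jet2 (\<lambda>t. U (z + of_real t * X)) (Re (G z * X)) (Re (G' z X * X))"
proof (rule jet2I)
  show "\<forall>\<^sub>F t in nhds 0. ((\<lambda>t. U (z + of_real t * X)) has_real_derivative Re (G (z + of_real t * X) * X)) (at t)"
    by (rule always_eventually) (intro allI U_line)
  show "((\<lambda>t. Re (G (z + of_real t * X) * X)) has_real_derivative Re (G' z X * X)) (at 0)"
    using G_line[of z X 0] by simp
qed simp

lemma continuous_U: "continuous_on S U"
  by (rule has_derivative_continuous_on, rule has_derivative_at_withinI, rule U_deriv)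

lemma continuous_G: "continuous_on S G"
  by (rule has_derivative_continuous_on, rule has_derivative_at_withinI, rule G_deriv)

lemma norm_G'_le: "norm (G' z h) \<le> (norm (G' z 1) + norm (G' z \<i>)) * norm h"
proof -
  have "norm (G' z h) \<le> \<bar>Re h\<bar> * norm (G' z 1) + \<bar>Im h\<bar> * norm (G' z \<i>)"
    unfolding G'_eq[of z h] by (rule order_trans[OF norm_triangle_ineq]) (simp add: norm_mult)
  also have "\<dots> \<le> norm h * norm (G' z 1) + norm h * norm (G' z \<i>)"
    by (intro add_mono mult_right_mono abs_Re_le_cmod abs_Im_le_cmod) auto
  finally show ?thesis by (simp add: algebra_simps)
qed

lemma taylor_bound:
  obtains B where "0 < B" "\<And>x y. norm x \<le> r \<Longrightarrow> norm y \<le> r \<Longrightarrow> \<bar>U y - U x - Re (G x * (y - x))\<bar> \<le> B * (norm (y - x))\<^sup>2"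
    "\<And>x. norm x \<le> r \<Longrightarrow> norm (G x) \<le> B"
proof -
  have "compact ((\<lambda>z. norm (G' z 1) + norm (G' z \<i>)) ` cball 0 r)"
    by (intro compact_continuous_image continuous_intros continuous_on_subset[OF G'_cont(1)]
        continuous_on_subset[OF G'_cont(2)] compact_cball; simp)
  then obtain B1 where B1: "\<forall>v\<in>(\<lambda>z. norm (G' z 1) + norm (G' z \<i>)) ` cball 0 r. norm v \<le> B1"
    using compact_imp_bounded bounded_iff by blast
  have "compact (G ` cball 0 r)"
    by (intro compact_continuous_image continuous_G compact_cball)
  then obtain B2 where B2: "\<forall>v\<in>G ` cball 0 r. norm v \<le> B2"
    using compact_imp_bounded bounded_iff by blast
  define B where "B = max 1 (max B1 B2)"
  have B0: "0 < B" by (simp add: B_def)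
  have Bd: "norm (G' z 1) + norm (G' z \<i>) \<le> B" if "norm z \<le> r" for z
  proof -
    have "norm (norm (G' z 1) + norm (G' z \<i>)) \<le> B1" using B1 that by simp
    then show ?thesis by (simp add: B_def)
  qed
  have BG: "norm (G z) \<le> B" if "norm z \<le> r" for z
  proof -
    have "norm (G z) \<le> B2" using B2 that by simp
    then show ?thesis by (simp add: B_def)
  qed
  have lip: "norm (G y - G x) \<le> B * norm (y - x)" if "norm x \<le> r" "norm y \<le> r" for x y
  proof (rule differentiable_bound[of "cball 0 r" G G' B])
    show "(G has_derivative G' z) (at z within cball 0 r)" for z
      by (rule has_derivative_at_withinI, rule G_deriv)
    show "onorm (G' z) \<le> B" if "z \<in> cball 0 r" for z
    proof (rule onorm_bound)
      fix h
      have "norm (G' z h) \<le> (norm (G' z 1) + norm (G' z \<i>)) * norm h" by (rule norm_G'_le)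
      also have "\<dots> \<le> B * norm h" using Bd that by (intro mult_right_mono) auto
      finally show "norm (G' z h) \<le> B * norm h" .
    qed (use B0 in simp)
  qed (use that in auto)
  have "\<bar>U y - U x - Re (G x * (y - x))\<bar> \<le> B * (norm (y - x))\<^sup>2" if xy: "norm x \<le> r" "norm y \<le> r" for x y
  proof -
    define f where "f w = U w - Re (G x * w)" for w
    have "norm (f y - f x) \<le> (B * norm (y - x)) * norm (y - x)"
    proof (rule differentiable_bound[of "closed_segment x y" f "\<lambda>w h. Re ((G w - G x) * h)"])
      fix w assume w: "w \<in> closed_segment x y"
      show "(f has_derivative (\<lambda>h. Re ((G w - G x) * h))) (at w within closed_segment x y)"
        unfolding f_def by (rule has_derivative_at_withinI) 
          (auto intro!: derivative_eq_intros U_deriv simp: algebra_simps)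
      have "closed_segment x y \<subseteq> cball 0 r" using xy by (intro closed_segment_subset) auto
      then have "norm w \<le> r" using w by auto
      then have "norm (G w - G x) \<le> B * norm (w - x)" using lip xy by simp
      also have "\<dots> \<le> B * norm (y - x)"
        using B0 dist_in_closed_segment(1)[OF w] by (intro mult_left_mono) (auto simp: dist_norm norm_minus_commute)
      finally have *: "norm (G w - G x) \<le> B * norm (y - x)" .
      show "onorm (\<lambda>h. Re ((G w - G x) * h)) \<le> B * norm (y - x)"
      proof (rule onorm_bound)
        fix h
        have "norm (Re ((G w - G x) * h)) \<le> norm ((G w - G x) * h)"
          unfolding real_norm_def by (rule abs_Re_le_cmod)
        also have "\<dots> \<le> B * norm (y - x) * norm h" unfolding norm_mult using * by (intro mult_right_mono) auto
        finally show "norm (Re ((G w - G x) * h)) \<le> B * norm (y - x) * norm h" .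
      qed (use B0 in simp)
    qed auto
    then show ?thesis by (simp add: f_def algebra_simps power2_eq_square)
  qed
  then show ?thesis using that[of B] B0 BG by simp
qed

end

definition ln_norm_deriv :: "complex \<Rightarrow> complex \<Rightarrow> real" where
  "ln_norm_deriv z X = Re (cnj z * X) / (norm z)\<^sup>2"

text \<open>
  The directions \<open>X\<close> and \<open>\<i> X\<close> are orthogonal and the gradient of \<open>log |z|\<close> has norm \<open>1 / |z|\<close>. Together with
  the formula for the second derivative in \<open>jet2_ln_norm\<close> this expresses that \<open>log |z|\<close> is harmonic.
\<close>

lemma ln_norm_deriv_rotate: "z \<noteq> 0 \<Longrightarrow> (ln_norm_deriv z X)\<^sup>2 + (ln_norm_deriv z (\<i> * X))\<^sup>2 = (norm X)\<^sup>2 / (norm z)\<^sup>2"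
proof -
  assume z: "z \<noteq> 0"
  have "(Re (cnj z * X))\<^sup>2 + (Re (cnj z * (\<i> * X)))\<^sup>2 = (norm z)\<^sup>2 * (norm X)\<^sup>2"
    unfolding cmod_power2 by (simp add: power2_eq_square algebra_simps)
  then show ?thesis using z
    unfolding ln_norm_deriv_def power_divide add_divide_distrib[symmetric] by (simp add: power2_eq_square)
qed

lemma norm_line_square: "(norm (z + of_real t * X))\<^sup>2 = (norm z)\<^sup>2 + t * (2 * Re (cnj z * X)) + t\<^sup>2 * (norm X)\<^sup>2"
  unfolding cmod_power2 by (simp add: power2_eq_square algebra_simps)

lemma jet2_norm_square: "jet2 (\<lambda>t. (norm (z + of_real t * X))\<^sup>2) (2 * Re (cnj z * X)) (2 * (norm X)\<^sup>2)"
  unfolding norm_line_square by (rule jet2_quadratic)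

lemma jet2_ln_norm:
  assumes "z \<noteq> 0"
  shows "jet2 (\<lambda>t. ln (norm (z + of_real t * X))) (ln_norm_deriv z X) ((norm X)\<^sup>2 / (norm z)\<^sup>2 - 2 * (ln_norm_deriv z X)\<^sup>2)"
proof -
  have "ln (norm w) = 1/2 * ln ((norm w)\<^sup>2)" for w :: complex
    by (cases "w = 0") (simp_all add: ln_realpow)
  note * = this
  show ?thesis
    unfolding *[of "z + _"]
    by (rule jet2_cong[OF jet2_cmult[OF jet2_ln[OF jet2_norm_square]]])
      (use assms in \<open>simp_all add: ln_norm_deriv_def power_divide power_mult_distrib field_simps del: times_complex.sel\<close>)
qed

context C2_plane begin

text \<open>
  Up to \<open>o(r\<^sup>2)\<close> the mean of \<open>U\<close> over the circle of radius \<open>r\<close> exceeds \<open>U(z)\<close> by \<open>r\<^sup>2 \<Delta>U(z) / 4\<close>.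
\<close>

lemma laplacian_nonneg_if_submean:
  assumes submean: "\<And>r. 0 < r \<Longrightarrow> 2 * pi * U z \<le> integral {0..2*pi} (\<lambda>\<theta>. U (z + of_real r * cis \<theta>))"
  shows "0 \<le> laplacian z"
proof (rule field_le_epsilon)
  fix e :: real assume e: "0 < e"
  define \<epsilon> where "\<epsilon> = e / 4"
  have \<epsilon>: "0 < \<epsilon>" using e by (simp add: \<epsilon>_def)
  obtain \<delta> where \<delta>: "0 < \<delta>" "\<And>y. norm (y - z) < \<delta> \<Longrightarrow> norm (G y - G z - G' z (y - z)) \<le> \<epsilon> * norm (y - z)"
    using G_deriv[of z] \<epsilon> unfolding has_derivative_at_alt by blast
  define t where "t = \<delta> / 2"
  have t: "0 < t" "t < \<delta>" using \<delta> by (auto simp: t_def)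
  define R where "R \<theta> = U z + t * Re (G z * cis \<theta>) + t\<^sup>2 / 2 * Re (G' z (cis \<theta>) * cis \<theta>) + \<epsilon> * t\<^sup>2" for \<theta>
  have up: "U (z + of_real t * cis \<theta>) \<le> R \<theta>" for \<theta>
  proof -
    define X where "X = cis \<theta>"
    have nX: "norm X = 1" by (simp add: X_def)
    define \<phi> where "\<phi> s = U (z + of_real s * X) - s * Re (G z * X) - s\<^sup>2 / 2 * Re (G' z X * X)" for s
    have der: "(\<phi> has_field_derivative (Re (G (z + of_real s * X) * X) - Re (G z * X) - s * Re (G' z X * X))) (at s)" for s
      unfolding \<phi>_def by (auto intro!: derivative_eq_intros U_line)
    obtain s where s: "0 < s" "s < t" "\<phi> t - \<phi> 0 = (t - 0) * (Re (G (z + of_real s * X) * X) - Re (G z * X) - s * Re (G' z X * X))"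
      using MVT2[of 0 t \<phi>, OF t(1) der] by blast
    have G's: "G' z (of_real s * X) = of_real s * G' z X"
      using G'_eq[of z "of_real s * X"] G'_eq[of z X] by (simp add: algebra_simps)
    have "Re (G (z + of_real s * X) * X) - Re (G z * X) - s * Re (G' z X * X) = Re ((G (z + of_real s * X) - G z - G' z (of_real s * X)) * X)"
      unfolding G's by (simp add: algebra_simps)
    also have "\<dots> \<le> norm ((G (z + of_real s * X) - G z - G' z (of_real s * X)) * X)" by (rule complex_Re_le_cmod)
    also have "\<dots> \<le> \<epsilon> * s"
      using \<delta>(2)[of "z + of_real s * X"] s t nX by (simp add: norm_mult)
    also have "\<dots> \<le> \<epsilon> * t" using s \<epsilon> by simp
    finally have "\<phi> t - \<phi> 0 \<le> t * (\<epsilon> * t)" unfolding s(3) using t by simp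
    then show ?thesis by (simp add: \<phi>_def R_def X_def power2_eq_square algebra_simps)
  qed
  define p q where "p = G' z 1" and "q = G' z \<i>"
  \<comment> \<open>an antiderivative of \<open>R\<close>\<close>
  define H where "H \<theta> = U z * \<theta> + t * (Re (G z) * sin \<theta> + Im (G z) * cos \<theta>)
    + t\<^sup>2 / 2 * (Re p * (\<theta> + sin \<theta> * cos \<theta>) / 2 + (Re q - Im p) * (sin \<theta>)\<^sup>2 / 2 - Im q * (\<theta> - sin \<theta> * cos \<theta>) / 2)
    + \<epsilon> * t\<^sup>2 * \<theta>" for \<theta>
  have R: "R \<theta> = U z + t * (Re (G z) * cos \<theta> - Im (G z) * sin \<theta>)
     + t\<^sup>2 / 2 * (Re p * (cos \<theta>)\<^sup>2 + (Re q - Im p) * (sin \<theta> * cos \<theta>) - Im q * (sin \<theta>)\<^sup>2) + \<epsilon> * t\<^sup>2" for \<theta>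
    unfolding R_def G'_eq[of z "cis \<theta>"] p_def[symmetric] q_def[symmetric]
    by (simp add: power2_eq_square algebra_simps)
  have s2: "(sin \<theta>)\<^sup>2 = 1 - (cos \<theta>)\<^sup>2" for \<theta> :: real by (rule sin_squared_eq)
  have "(H has_real_derivative R \<theta>) (at \<theta>)" for \<theta>
  proof -
    define lin sc sq where "lin \<theta> = Re (G z) * sin \<theta> + Im (G z) * cos \<theta>" 
      and "sc \<theta> = sin \<theta> * cos \<theta>" and "sq \<theta> = (sin \<theta>)\<^sup>2" for \<theta>
    have d: "(lin has_real_derivative Re (G z) * cos \<theta> - Im (G z) * sin \<theta>) (at \<theta>)"
      "(sc has_real_derivative (cos \<theta>)\<^sup>2 - (sin \<theta>)\<^sup>2) (at \<theta>)"
      "(sq has_real_derivative 2 * (sin \<theta> * cos \<theta>)) (at \<theta>)"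
      unfolding lin_def sc_def sq_def by (auto intro!: derivative_eq_intros simp: power2_eq_square)
    have H: "H = (\<lambda>\<theta>. U z * \<theta> + t * lin \<theta> + t\<^sup>2 / 2 * (Re p / 2 * (\<theta> + sc \<theta>)
        + (Re q - Im p) / 2 * sq \<theta> - Im q / 2 * (\<theta> - sc \<theta>)) + \<epsilon> * t\<^sup>2 * \<theta>)"
      by (simp add: H_def lin_def sc_def sq_def fun_eq_iff mult.assoc)
    have "(H has_real_derivative (U z * 1 + t * (Re (G z) * cos \<theta> - Im (G z) * sin \<theta>)
     + t\<^sup>2 / 2 * (Re p / 2 * (1 + ((cos \<theta>)\<^sup>2 - (sin \<theta>)\<^sup>2)) + (Re q - Im p) / 2 * (2 * (sin \<theta> * cos \<theta>))
        - Im q / 2 * (1 - ((cos \<theta>)\<^sup>2 - (sin \<theta>)\<^sup>2))) + \<epsilon> * t\<^sup>2 * 1)) (at \<theta>)"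
      unfolding H by (intro DERIV_add DERIV_diff DERIV_cmult DERIV_ident d)
    moreover have "1 + ((cos \<theta>)\<^sup>2 - (sin \<theta>)\<^sup>2) = 2 * (cos \<theta>)\<^sup>2" "1 - ((cos \<theta>)\<^sup>2 - (sin \<theta>)\<^sup>2) = 2 * (sin \<theta>)\<^sup>2"
      using s2[of \<theta>] by simp_all
    ultimately show ?thesis unfolding R by simp
  qed
  then have "(R has_integral (H (2*pi) - H 0)) {0..2*pi}"
    by (intro fundamental_theorem_of_calculus) (auto simp: has_real_derivative_iff_has_vector_derivative[symmetric] intro: has_field_derivative_at_within)
  moreover have "H (2*pi) - H 0 = 2 * pi * (U z + t\<^sup>2 / 4 * laplacian z + \<epsilon> * t\<^sup>2)"
    by (simp add: H_def laplacian_def p_def q_def field_simps)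
  ultimately have R_int: "(R has_integral 2 * pi * (U z + t\<^sup>2 / 4 * laplacian z + \<epsilon> * t\<^sup>2)) {0..2*pi}" by simp
  have "(\<lambda>\<theta>. U (z + of_real t * cis \<theta>)) integrable_on {0..2*pi}"
    by (intro integrable_continuous_real continuous_on_compose2[OF continuous_U[of UNIV]] continuous_intros) auto
  then have "integral {0..2*pi} (\<lambda>\<theta>. U (z + of_real t * cis \<theta>)) \<le> integral {0..2*pi} R"
    using R_int up by (intro integral_le) auto
  then have "2 * pi * U z \<le> 2 * pi * (U z + t\<^sup>2 / 4 * laplacian z + \<epsilon> * t\<^sup>2)"
    using submean[OF t(1)] integral_unique[OF R_int] by linarith
  then have "U z \<le> U z + t\<^sup>2 / 4 * laplacian z + \<epsilon> * t\<^sup>2" by (subst (asm) mult_le_cancel_left_pos) auto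
  then have "0 \<le> t\<^sup>2 * (laplacian z + 4 * \<epsilon>)" by (simp add: algebra_simps)
  then show "0 \<le> laplacian z + e" using t by (simp add: \<epsilon>_def zero_le_mult_iff)
qed

end

section \<open>Maxima on circles\<close>

locale subharmonic_C2 = C2_plane +
  assumes laplacian_nonneg: "0 \<le> laplacian z"
begin

text \<open>
  The maximum principle on an annulus for \<open>U - a log |z|\<close>, made strict by adding \<open>\<epsilon> |z|\<^sup>2\<close>.
\<close>

lemma three_circles:
  assumes r: "0 < r1" "r1 < r2"
    and b: "\<And>z. norm z = r1 \<or> norm z = r2 \<Longrightarrow> U z \<le> A + a * ln (norm z)"
    and z0: "r1 \<le> norm z0" "norm z0 \<le> r2"
  shows "U z0 \<le> A + a * ln (norm z0)"
proof (rule ccontr)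
  assume n: "\<not> ?thesis"
  define \<eta> where "\<eta> = U z0 - a * ln (norm z0) - A"
  have \<eta>: "0 < \<eta>" using n by (simp add: \<eta>_def)
  \<comment> \<open>the perturbation costs at most \<open>\<eta> / 2\<close> on the annulus\<close>
  define \<epsilon> where "\<epsilon> = \<eta> / (2 * r2\<^sup>2)"
  have \<epsilon>: "0 < \<epsilon>" using \<eta> r by (simp add: \<epsilon>_def)
  define w where "w z = U z + (- a) * ln (norm z) + \<epsilon> * (norm z)\<^sup>2" for z
  define S where "S = cball 0 r2 - ball (0::complex) r1"
  have S: "compact S" unfolding S_def by (intro compact_diff) auto
  have S0: "z \<in> S \<longleftrightarrow> r1 \<le> norm z \<and> norm z \<le> r2" for z by (auto simp: S_def)
  have cont: "continuous_on S w"
    unfolding w_def by (intro continuous_intros continuous_U) (use r S0 in auto)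
  obtain z where z: "z \<in> S" "\<And>y. y \<in> S \<Longrightarrow> w y \<le> w z"
    using continuous_attains_sup[OF S _ cont] z0 S0 by blast
  have nz: "z \<noteq> 0" using z(1) S0 r by auto
  have wz: "A + \<eta> \<le> w z"
  proof -
    have "A + \<eta> \<le> w z0" using \<epsilon> by (simp add: \<eta>_def w_def)
    then show ?thesis using z(2)[of z0] z0 S0 by simp
  qed
  have "norm z \<noteq> r1 \<and> norm z \<noteq> r2"
  proof (rule ccontr)
    assume "\<not> ?thesis"
    then have "w z \<le> A + \<epsilon> * (norm z)\<^sup>2" using b[of z] by (auto simp: w_def)
    also have "\<dots> \<le> A + \<epsilon> * r2\<^sup>2" using z(1) S0 \<epsilon> by (intro add_left_mono mult_left_mono power_mono) auto
    also have "\<dots> = A + \<eta> / 2" using r by (simp add: \<epsilon>_def)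
    finally show False using wz \<eta> by simp
  qed
  then have int: "r1 < norm z" "norm z < r2" using z(1) S0 by (auto simp: less_le)
  have "\<forall>\<^sub>F t in nhds 0. w (z + of_real t * X) \<le> w (z + of_real 0 * X)" for X
  proof -
    have "((\<lambda>t. norm (z + of_real t * X)) \<longlongrightarrow> norm (z + of_real 0 * X)) (nhds 0)"
      by (intro tendsto_intros) (simp_all add: filterlim_ident)
    then have "\<forall>\<^sub>F t in nhds 0. norm (z + of_real t * X) \<in> {r1<..<r2}"
      by (rule topological_tendstoD) (use int in auto)
    then show ?thesis by eventually_elim (use z(2) S0 in auto)
  qed
  note mx = this
  have jet: "jet2 (\<lambda>t. w (z + of_real t * X)) (Re (G z * X) + (- a) * ln_norm_deriv z X + \<epsilon> * (2 * Re (cnj z * X)))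
     (Re (G' z X * X) + (- a) * ((norm X)\<^sup>2 / (norm z)\<^sup>2 - 2 * (ln_norm_deriv z X)\<^sup>2) + \<epsilon> * (2 * (norm X)\<^sup>2))" for X
    unfolding w_def by (intro jet2_add jet2_U jet2_cmult jet2_ln_norm nz jet2_norm_square)
  have lin: "(- a) * (k - 2 * P) + (- a) * (k - 2 * Q) = 0" if "P + Q = k" for P Q k :: real
    unfolding that[symmetric] by (simp add: algebra_simps)
  have "(- a) * (1 / (norm z)\<^sup>2 - 2 * (ln_norm_deriv z 1)\<^sup>2) + (- a) * (1 / (norm z)\<^sup>2 - 2 * (ln_norm_deriv z \<i>)\<^sup>2) = 0"
    using ln_norm_deriv_rotate[OF nz, of 1] by (intro lin) simp
  moreover have "Re (G' z 1 * 1) + Re (G' z \<i> * \<i>) = laplacian z" using laplacian_rotate[of z 1] by simp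
  ultimately have "laplacian z + 4 * \<epsilon> \<le> 0"
    using jet2_max(2)[OF jet[of 1] mx] jet2_max(2)[OF jet[of \<i>] mx] by simp
  then show False using laplacian_nonneg[of z] \<epsilon> by simp
qed

definition max_on_circle :: "real \<Rightarrow> real" where
  "max_on_circle r = (SUP z\<in>{z. norm z = r}. U z)"

lemma circle_image_compact: "compact (U ` {z. norm z = r})"
proof (intro compact_continuous_image continuous_U)
  have "{z :: complex. norm z = r} = sphere 0 r" by auto
  then show "compact {z :: complex. norm z = r}" by simp
qed

lemma le_max_on_circle: "U z \<le> max_on_circle (norm z)"
  unfolding max_on_circle_def
  by (rule cSUP_upper) (auto intro!: bounded_imp_bdd_above compact_imp_bounded circle_image_compact)

lemma max_on_circle_le:
  assumes "0 \<le> r" "\<And>z. norm z = r \<Longrightarrow> U z \<le> c"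
  shows "max_on_circle r \<le> c"
  unfolding max_on_circle_def using assms by (intro cSUP_least) (auto intro: exI[of _ "of_real r"])

lemma max_on_circle_log_convex:
  assumes "0 < r1" "r1 < r" "r < r2"
  shows "(max_on_circle r - max_on_circle r1) * (ln r2 - ln r1) \<le> (max_on_circle r2 - max_on_circle r1) * (ln r - ln r1)"
proof -
  define a where "a = (max_on_circle r2 - max_on_circle r1) / (ln r2 - ln r1)"
  have l: "0 < ln r2 - ln r1" using assms by simp
  have "max_on_circle r \<le> (max_on_circle r1 - a * ln r1) + a * ln r"
  proof (rule max_on_circle_le)
    fix z :: complex assume z: "norm z = r"
    have "U y \<le> (max_on_circle r1 - a * ln r1) + a * ln (norm y)" if "norm y = r1 \<or> norm y = r2" for y
      using that
    proof
      assume "norm y = r1"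
      then show ?thesis using le_max_on_circle[of y] by simp
    next
      assume y: "norm y = r2"
      have "a * (ln r2 - ln r1) = max_on_circle r2 - max_on_circle r1" using l unfolding a_def by simp
      then have "a * ln r2 - a * ln r1 = max_on_circle r2 - max_on_circle r1" by (simp only: right_diff_distrib)
      then show ?thesis using le_max_on_circle[of y] unfolding y by linarith
    qed
    then have "U z \<le> (max_on_circle r1 - a * ln r1) + a * ln (norm z)"
      by (rule three_circles[of r1 r2, rotated 2]) (use assms z in auto)
    then show "U z \<le> (max_on_circle r1 - a * ln r1) + a * ln r" using z by simp
  qed (use assms in simp)
  then have "max_on_circle r - max_on_circle r1 \<le> a * (ln r - ln r1)"
    unfolding right_diff_distrib by linarith
  then have "(max_on_circle r - max_on_circle r1) * (ln r2 - ln r1) \<le> (a * (ln r - ln r1)) * (ln r2 - ln r1)"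
    using l by (intro mult_right_mono) simp_all
  also have "\<dots> = (max_on_circle r2 - max_on_circle r1) * (ln r - ln r1)" using l unfolding a_def by simp
  finally show ?thesis .
qed

text \<open>
  The slopes of the chords of a convex function that start at one point are increasing.
\<close>

lemma max_on_circle_growth:
  obtains L where "((\<lambda>r. ereal (max_on_circle r / ln r)) \<longlongrightarrow> L) at_top"
    "\<And>r. 1 < r \<Longrightarrow> ereal ((max_on_circle r - max_on_circle 1) / ln r) \<le> L"
proof -
  define s where "s r = (max_on_circle r - max_on_circle 1) / ln r" for r
  have mono: "s r \<le> s r'" if "1 < r" "r \<le> r'" for r r'
  proof (cases "r = r'")
    case False
    then have "(max_on_circle r - max_on_circle 1) * ln r' \<le> (max_on_circle r' - max_on_circle 1) * ln r"
      using max_on_circle_log_convex[of 1 r r'] that by simp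
    then show ?thesis using that by (simp add: s_def field_simps)
  qed simp
  define L where "L = (SUP r\<in>{1<..}. ereal (s r))"
  have le: "ereal (s r) \<le> L" if "1 < r" for r unfolding L_def using that by (intro SUP_upper) auto
  have lim: "((\<lambda>r. ereal (s r)) \<longlongrightarrow> L) at_top"
  proof (rule order_tendstoI)
    fix a assume "a < L"
    then obtain r where r: "1 < r" "a < ereal (s r)" unfolding L_def less_SUP_iff by auto
    show "\<forall>\<^sub>F x in at_top. a < ereal (s x)"
      using eventually_ge_at_top[of "r"] by eventually_elim (rule less_le_trans[OF r(2)], simp add: mono r(1))
  next
    fix a assume "L < a"
    show "\<forall>\<^sub>F x in at_top. ereal (s x) < a"
      by (rule eventually_mono[OF eventually_gt_at_top[of "1::real"]]) (rule le_less_trans[OF le \<open>L < a\<close>])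
  qed
  have "((\<lambda>r. max_on_circle 1 / ln r) \<longlongrightarrow> 0) at_top"
    by (intro real_tendsto_divide_at_top[OF tendsto_const] ln_at_top)
  then have "((\<lambda>r. ereal (max_on_circle 1 / ln r)) \<longlongrightarrow> ereal 0) at_top" by (rule tendsto_ereal)
  from tendsto_add_ereal_general2[OF _ this lim] have "((\<lambda>r. ereal (max_on_circle 1 / ln r) + ereal (s r)) \<longlongrightarrow> L) at_top"
    by simp
  then have "((\<lambda>r. ereal (max_on_circle r / ln r)) \<longlongrightarrow> L) at_top"
    by (simp add: s_def diff_divide_distrib)
  then show ?thesis by (rule that) (use le in \<open>simp add: s_def\<close>)
qed

end


section \<open>Chains of minimal energy\<close>

text \<open>
  Two consecutive steps \<open>D'\<close> and \<open>D\<close> of a chain, with weights \<open>a0\<close> and \<open>a1\<close> at their starting points and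
  \<open>\<Gamma>\<close> the complex gradient of the weight at the common vertex, satisfy the discrete geodesic equation
  \<open>stat\<close>. It implies first that \<open>D\<close> and \<open>D'\<close> differ by a quantity of second order in their lengths. Paired
  with \<open>D + D'\<close> it then expresses the difference of the two energies by terms in which the third order parts
  cancel; what remains is of fourth order. This is conservation of kinetic energy along a geodesic, in
  discrete form.
\<close>

lemma edge_change:
  fixes D D' \<Gamma> :: complex and a0 a1 A :: real
  assumes stat: "\<And>V. Re (\<Gamma> * V) * (norm D)\<^sup>2 - 2 * a1 * Re (cnj D * V) + 2 * a0 * Re (cnj D' * V) = 0"
    and tay: "\<bar>a0 - a1 + Re (\<Gamma> * D')\<bar> \<le> A * (norm D')\<^sup>2"
    and lip: "\<bar>a0 - a1\<bar> \<le> A * norm D'" and \<Gamma>: "norm \<Gamma> \<le> A"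
    and low: "1 \<le> A" "1 \<le> A * a0" "1 \<le> A * a1"
  shows "\<bar>a1 * (norm D)\<^sup>2 - a0 * (norm D')\<^sup>2\<bar> \<le> 2 * A^5 * (a1 * (norm D)\<^sup>2 + a0 * (norm D')\<^sup>2)\<^sup>2"
proof -
  define m where "m = (norm D)\<^sup>2 + (norm D')\<^sup>2"
  have m0: "0 \<le> m" by (simp add: m_def)
  have A0: "0 < A" using low by simp
  have a0: "0 < a0" using low A0 by (metis less_le_trans zero_less_mult_pos zero_less_one)
  have prod: "norm D' * norm D \<le> m / 2"
    using zero_le_power2[of "norm D - norm D'"] by (simp add: m_def power2_diff algebra_simps)
  \<comment> \<open>the geodesic equation as an equation between complex numbers\<close>
  define v where "v = of_real ((norm D)\<^sup>2) * \<Gamma> - 2 * of_real a1 * cnj D + 2 * of_real a0 * cnj D'"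
  have "Re (v * cnj v) = 0"
    using stat[of "cnj v"] unfolding v_def by (simp add: algebra_simps)
  then have v: "v = 0" by (simp add: complex_mult_cnj)
       (metis complex_eq_iff sum_power2_eq_zero_iff zero_complex.sel)
  have step: "norm (D - D') \<le> A\<^sup>2 * m"
  proof -
    have "2 * of_real a0 * (cnj D - cnj D') = of_real ((norm D)\<^sup>2) * \<Gamma> + 2 * of_real (a0 - a1) * cnj D"
      using v unfolding v_def by (simp add: algebra_simps)
    then have "norm (2 * of_real a0 * (cnj D - cnj D')) = norm (of_real ((norm D)\<^sup>2) * \<Gamma> + 2 * of_real (a0 - a1) * cnj D)"
      by simp
    also have "\<dots> \<le> (norm D)\<^sup>2 * norm \<Gamma> + 2 * \<bar>a0 - a1\<bar> * norm D"
      by (rule order_trans[OF norm_triangle_ineq]) (simp add: norm_mult norm_power flip: of_real_diff)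
    also have "\<dots> \<le> (norm D)\<^sup>2 * A + 2 * (A * norm D') * norm D"
      by (intro add_mono mult_left_mono mult_right_mono lip \<Gamma>) auto
    also have "\<dots> = A * ((norm D)\<^sup>2 + 2 * (norm D' * norm D))" by (simp add: algebra_simps)
    also have "\<dots> \<le> A * (2 * m)"
    proof (rule mult_left_mono)
      have "x + 2 * p \<le> 2 * (x + y)" if "p \<le> (x + y) / 2" "0 \<le> y" for x y p :: real using that by simp
      from this[OF prod[unfolded m_def]] show "(norm D)\<^sup>2 + 2 * (norm D' * norm D) \<le> 2 * m" by (simp add: m_def)
    qed (use A0 in simp)
    finally have "a0 * norm (D - D') \<le> A * m"
      using a0 by (simp add: norm_mult flip: complex_cnj_diff)
    then have "A * (a0 * norm (D - D')) \<le> A * (A * m)" using A0 by (intro mult_left_mono) auto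
    moreover have "1 * norm (D - D') \<le> A * a0 * norm (D - D')" using low by (intro mult_right_mono) auto
    ultimately show ?thesis by (simp add: power2_eq_square mult.assoc)
  qed
  define R where "R = a0 - a1 + Re (\<Gamma> * D')"
  have cs: "Re (cnj D * D) = (norm D)\<^sup>2" "Re (cnj D' * D') = (norm D')\<^sup>2" "Re (cnj D' * D) = Re (cnj D * D')"
    unfolding cmod_power2 by (simp_all add: power2_eq_square)
  have "2 * (a1 * (norm D)\<^sup>2 - a0 * (norm D')\<^sup>2) = Re (\<Gamma> * (D + D')) * (norm D)\<^sup>2 + 2 * (a0 - a1) * Re (cnj D * D')"
    using stat[of "D + D'"] by (simp add: distrib_left cs del: times_complex.sel) (simp add: algebra_simps)
  also have "\<dots> = Re (\<Gamma> * (D - D')) * (norm D)\<^sup>2 + 2 * Re (\<Gamma> * D') * Re (cnj D * (D - D')) + 2 * R * Re (cnj D * D')"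
    unfolding R_def by (simp add: distrib_left right_diff_distrib cs del: times_complex.sel) (simp add: algebra_simps)
  finally have id: "2 * (a1 * (norm D)\<^sup>2 - a0 * (norm D')\<^sup>2) = \<dots>" .
  have "\<bar>Re (\<Gamma> * (D - D'))\<bar> \<le> A * (A\<^sup>2 * m)"
    using mult_mono[OF \<Gamma> step] A0 by (intro order_trans[OF abs_Re_le_cmod]) (auto simp: norm_mult)
  then have t1: "\<bar>Re (\<Gamma> * (D - D')) * (norm D)\<^sup>2\<bar> \<le> A * (A\<^sup>2 * m) * m"
    unfolding abs_mult using m0 A0 by (intro mult_mono) (auto simp: m_def)
  have "\<bar>Re (\<Gamma> * D')\<bar> \<le> A * norm D'"
    using mult_right_mono[OF \<Gamma>, of "norm D'"] by (intro order_trans[OF abs_Re_le_cmod]) (auto simp: norm_mult)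
  moreover have "\<bar>Re (cnj D * (D - D'))\<bar> \<le> norm D * (A\<^sup>2 * m)"
    using mult_left_mono[OF step, of "norm D"] by (intro order_trans[OF abs_Re_le_cmod]) (auto simp: norm_mult)
  ultimately have "\<bar>Re (\<Gamma> * D')\<bar> * \<bar>Re (cnj D * (D - D'))\<bar> \<le> (A * norm D') * (norm D * (A\<^sup>2 * m))"
    using A0 by (intro mult_mono) auto
  also have "\<dots> = A * A\<^sup>2 * m * (norm D' * norm D)" by (simp add: algebra_simps)
  also have "\<dots> \<le> A * A\<^sup>2 * m * (m / 2)" using A0 m0 prod by (intro mult_left_mono) auto
  finally have t2: "\<bar>2 * Re (\<Gamma> * D') * Re (cnj D * (D - D'))\<bar> \<le> A * A\<^sup>2 * m * m"
    by (simp add: abs_mult del: times_complex.sel)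
  have "\<bar>R\<bar> \<le> A * m" unfolding R_def
    by (rule order_trans[OF tay]) (use A0 in \<open>simp add: m_def\<close>)
  moreover have "\<bar>Re (cnj D * D')\<bar> \<le> m / 2"
    by (rule order_trans[OF abs_Re_le_cmod]) (use prod in \<open>simp add: norm_mult mult.commute\<close>)
  ultimately have "\<bar>R\<bar> * \<bar>Re (cnj D * D')\<bar> \<le> A * m * (m / 2)" using A0 m0 by (intro mult_mono) auto
  then have t3: "\<bar>2 * R * Re (cnj D * D')\<bar> \<le> A * m * m" by (simp add: abs_mult del: times_complex.sel)
  have "2 * \<bar>a1 * (norm D)\<^sup>2 - a0 * (norm D')\<^sup>2\<bar> = \<bar>2 * (a1 * (norm D)\<^sup>2 - a0 * (norm D')\<^sup>2)\<bar>"
    by (simp only: abs_mult abs_numeral)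
  also have "\<dots> \<le> A * (A\<^sup>2 * m) * m + A * A\<^sup>2 * m * m + A * m * m"
    unfolding id using t1 t2 t3 by linarith
  also have "\<dots> \<le> 4 * (A^3 * m\<^sup>2)"
  proof -
    have "A * 1 \<le> A * A\<^sup>2" using A0 low(1) by (intro mult_left_mono) (auto simp: one_le_power)
    then have "A * (m * m) \<le> A * A\<^sup>2 * (m * m)" using m0 by (intro mult_right_mono) auto
    moreover have "A^3 * m\<^sup>2 = A * A\<^sup>2 * (m * m)" by (simp add: power2_eq_square power3_eq_cube)
    moreover have "0 \<le> A * A\<^sup>2 * (m * m)" using A0 by simp
    moreover have "A * (A\<^sup>2 * m) * m = A * A\<^sup>2 * (m * m)" "A * A\<^sup>2 * m * m = A * A\<^sup>2 * (m * m)" "A * m * m = A * (m * m)"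
      by (simp_all only: mult.assoc)
    ultimately show ?thesis by linarith
  qed
  finally have main: "\<bar>a1 * (norm D)\<^sup>2 - a0 * (norm D')\<^sup>2\<bar> \<le> 2 * (A^3 * m\<^sup>2)" by simp
  have "m \<le> A * (a1 * (norm D)\<^sup>2 + a0 * (norm D')\<^sup>2)"
    using mult_right_mono[OF low(2), of "(norm D')\<^sup>2"] mult_right_mono[OF low(3), of "(norm D)\<^sup>2"]
    by (simp add: m_def algebra_simps)
  then have "m\<^sup>2 \<le> (A * (a1 * (norm D)\<^sup>2 + a0 * (norm D')\<^sup>2))\<^sup>2" using m0 by (intro power_mono) auto
  then have "A^3 * m\<^sup>2 \<le> A^3 * (A\<^sup>2 * (a1 * (norm D)\<^sup>2 + a0 * (norm D')\<^sup>2)\<^sup>2)"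
    using A0 by (intro mult_left_mono) (auto simp: power_mult_distrib)
  also have "\<dots> = A^5 * (a1 * (norm D)\<^sup>2 + a0 * (norm D')\<^sup>2)\<^sup>2"
    by (simp add: mult.assoc[symmetric] power_add[symmetric])
  finally show ?thesis using main by linarith
qed

text \<open>
  By \<open>step\<close> the total variation of \<open>e\<close> is at most \<open>4 C\<close> times its maximum times its sum. By
  \<open>small\<close> this is at most half of the maximum.
\<close>

lemma last_term_le_twice_average:
  fixes e :: "nat \<Rightarrow> real"
  assumes e0: "\<And>i. 0 \<le> e i" and N: "0 < N" and C: "0 \<le> C"
    and step: "\<And>i. Suc i < N \<Longrightarrow> \<bar>e (Suc i) - e i\<bar> \<le> C * (e (Suc i) + e i)\<^sup>2"
    and small: "8 * C * (\<Sum>i<N. e i) \<le> 1"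
  shows "real N * e (N - 1) \<le> 2 * (\<Sum>i<N. e i)"
proof -
  define P where "P = Max (e ` {..<N})"
  have eP: "e i \<le> P" if "i < N" for i unfolding P_def using that by (intro Max_ge) auto
  have "P \<in> e ` {..<N}" unfolding P_def using N by (intro Max_in) auto
  then obtain k where k: "k < N" "e k = P" by auto
  have P0: "0 \<le> P" using k e0 by metis
  \<comment> \<open>on \<open>[0, 2 P]\<close> the square in the hypothesis is at most \<open>2 P\<close> times its base\<close>
  have var: "(\<Sum>i<N-1. \<bar>e (Suc i) - e i\<bar>) \<le> P / 2"
  proof -
    have "(\<Sum>i<N-1. \<bar>e (Suc i) - e i\<bar>) \<le> (\<Sum>i<N-1. 2 * C * P * (e (Suc i) + e i))"
    proof (rule sum_mono)
      fix i assume "i \<in> {..<N-1}"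
      then have i: "Suc i < N" by auto
      have "(e (Suc i) + e i)\<^sup>2 \<le> (2 * P) * (e (Suc i) + e i)"
        unfolding power2_eq_square using eP[of i] eP[of "Suc i"] i e0 by (intro mult_right_mono) auto
      then have "C * (e (Suc i) + e i)\<^sup>2 \<le> C * ((2 * P) * (e (Suc i) + e i))" using C by (intro mult_left_mono) auto
      then show "\<bar>e (Suc i) - e i\<bar> \<le> 2 * C * P * (e (Suc i) + e i)" using step[OF i] by (simp add: algebra_simps)
    qed
    also have "\<dots> = 2 * C * P * ((\<Sum>i<N-1. e (Suc i)) + (\<Sum>i<N-1. e i))"
      by (simp add: sum_distrib_left[symmetric] sum.distrib)
    also have "\<dots> \<le> 2 * C * P * ((\<Sum>i<N. e i) + (\<Sum>i<N. e i))"
    proof (intro mult_left_mono add_mono)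
      have "(\<Sum>i<N. e i) = e 0 + (\<Sum>i<N-1. e (Suc i))"
        using N sum.lessThan_Suc_shift[of e "N-1"] by simp
      then show "(\<Sum>i<N-1. e (Suc i)) \<le> (\<Sum>i<N. e i)" using e0[of 0] by simp
      show "(\<Sum>i<N-1. e i) \<le> (\<Sum>i<N. e i)" using e0 by (intro sum_mono2) auto
    qed (use C P0 in auto)
    also have "\<dots> = (P / 2) * (8 * C * (\<Sum>i<N. e i))" by (simp add: algebra_simps)
    also have "\<dots> \<le> P / 2" using mult_left_mono[OF small, of "P/2"] P0 by simp
    finally show ?thesis .
  qed
  have tele: "\<bar>e j - e i\<bar> \<le> (\<Sum>l\<in>{i..<j}. \<bar>e (Suc l) - e l\<bar>)" if "i \<le> j" for i j
    using that
  proof (induction j rule: dec_induct)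
    case (step j)
    then show ?case by simp
  qed simp
  have close: "\<bar>e j - e i\<bar> \<le> P / 2" if "i \<le> j" "j < N" for i j
  proof -
    have "\<bar>e j - e i\<bar> \<le> (\<Sum>l\<in>{i..<j}. \<bar>e (Suc l) - e l\<bar>)" by (rule tele[OF that(1)])
    also have "\<dots> \<le> (\<Sum>l<N-1. \<bar>e (Suc l) - e l\<bar>)" using that by (intro sum_mono2) auto
    finally show ?thesis using var by simp
  qed
  have "e (N-1) / 2 \<le> e j" if "j < N" for j
  proof -
    have "\<bar>e k - e j\<bar> \<le> P / 2"
      using close[of j k] close[of k j] k that by (cases "j \<le> k") (auto simp: abs_minus_commute)
    then have "P / 2 \<le> e j" using k by linarith
    then show ?thesis using eP[of "N-1"] N by simp
  qed
  then have "(\<Sum>j<N. e (N-1) / 2) \<le> (\<Sum>j<N. e j)" by (intro sum_mono) auto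
  then show ?thesis by simp
qed

context subharmonic_C2 begin

definition weight :: "complex \<Rightarrow> real" where "weight z = exp (- 2 * U z)"

definition energy :: "nat \<Rightarrow> (nat \<Rightarrow> complex) \<Rightarrow> real" where
  "energy N z = real N * (\<Sum>i<N. weight (z i) * (norm (z (Suc i) - z i))\<^sup>2)"

text \<open>
  The first and second derivative at \<open>t = 0\<close> of the energy of one step along the variation \<open>z + t Y\<close>.
\<close>

definition edge_var :: "(nat \<Rightarrow> complex) \<Rightarrow> (nat \<Rightarrow> complex) \<Rightarrow> nat \<Rightarrow> real" where
  "edge_var z Y i = weight (z i) * (2 * Re (cnj (z (Suc i) - z i) * (Y (Suc i) - Y i))
      - 2 * Re (G (z i) * Y i) * (norm (z (Suc i) - z i))\<^sup>2)"

definition edge_var2 :: "(nat \<Rightarrow> complex) \<Rightarrow> (nat \<Rightarrow> complex) \<Rightarrow> nat \<Rightarrow> real" where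
  "edge_var2 z Y i = weight (z i) * ((4 * (Re (G (z i) * Y i))\<^sup>2 - 2 * Re (G' (z i) (Y i) * Y i)) * (norm (z (Suc i) - z i))\<^sup>2
      - 8 * Re (G (z i) * Y i) * Re (cnj (z (Suc i) - z i) * (Y (Suc i) - Y i))
      + 2 * (norm (Y (Suc i) - Y i))\<^sup>2)"

lemma jet2_weight:
  "jet2 (\<lambda>t. weight (z + of_real t * X)) (- 2 * weight z * Re (G z * X))
     (weight z * (4 * (Re (G z * X))\<^sup>2 - 2 * Re (G' z X * X)))"
  unfolding weight_def
  by (rule jet2_cong[OF jet2_exp[OF jet2_cmult[OF jet2_U]]]) (simp_all add: power_mult_distrib algebra_simps del: times_complex.sel)

lemma jet2_energy:
  "jet2 (\<lambda>t. energy N (\<lambda>i. z i + of_real t * Y i)) (real N * (\<Sum>i<N. edge_var z Y i)) (real N * (\<Sum>i<N. edge_var2 z Y i))"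
  unfolding energy_def
proof (intro jet2_cmult jet2_sum)
  fix i
  have "jet2 (\<lambda>t. weight (z i + of_real t * Y i) * (norm ((z (Suc i) - z i) + of_real t * (Y (Suc i) - Y i)))\<^sup>2) (edge_var z Y i) (edge_var2 z Y i)"
    by (rule jet2_cong[OF jet2_mult[OF jet2_weight jet2_norm_square]])
      (simp_all add: edge_var_def edge_var2_def algebra_simps del: times_complex.sel)
  moreover have eq: "z (Suc i) + of_real t * Y (Suc i) - (z i + of_real t * Y i) = (z (Suc i) - z i) + of_real t * (Y (Suc i) - Y i)" for t :: real
    by (simp add: algebra_simps)
  ultimately show "jet2 (\<lambda>t. weight (z i + of_real t * Y i) * (norm (z (Suc i) + of_real t * Y (Suc i) - (z i + of_real t * Y i)))\<^sup>2) (edge_var z Y i) (edge_var2 z Y i)"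
    unfolding eq by simp
qed

lemma edge_var_add: "edge_var z (\<lambda>i. Y i + Y' i) i = edge_var z Y i + edge_var z Y' i"
  by (simp add: edge_var_def algebra_simps)

text \<open>
  The recursion makes the logarithmic derivative of each step, \<open>(X\<^sub>i\<^sub>+\<^sub>1 - X\<^sub>i) / (z\<^sub>i\<^sub>+\<^sub>1 - z\<^sub>i) - G(z\<^sub>i) X\<^sub>i\<close>,
  equal to 1. In the sum of the second derivatives in the directions \<open>X\<close> and \<open>\<i> X\<close> everything then cancels
  except \<open>4\<close> times the energy and a multiple of \<open>-\<Delta>U\<close>. The recursion is free of divisions, so steps of length
  zero do no harm.
\<close>

lemma balanced_energy_jets:
  assumes X: "\<And>i. X (Suc i) = X i + (z (Suc i) - z i) * (1 + G (z i) * X i)"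
  obtains Q1 Q2 where
    "jet2 (\<lambda>t. energy N (\<lambda>i. z i + of_real t * X i)) (2 * energy N z) Q1"
    "jet2 (\<lambda>t. energy N (\<lambda>i. z i + of_real t * (\<i> * X i))) 0 Q2"
    "Q1 + Q2 \<le> 4 * energy N z"
    "real N * (\<Sum>i<N. edge_var z X i) = 2 * energy N z"
proof -
  have d: "X (Suc i) - X i = (z (Suc i) - z i) * (1 + G (z i) * X i)" 
    "\<i> * X (Suc i) - \<i> * X i = (z (Suc i) - z i) * (\<i> * (1 + G (z i) * X i))" for i
    by (simp_all add: X algebra_simps)
  have sq: "cnj D * (D * b) = of_real ((norm D)\<^sup>2) * b" for D b :: complex
    by (simp only: mult.assoc[symmetric] complex_norm_square mult.commute[of "cnj D" D])
  have v1: "edge_var z X i = 2 * (weight (z i) * (norm (z (Suc i) - z i))\<^sup>2)" for i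
    unfolding edge_var_def d sq by (simp add: algebra_simps)
  have v2: "edge_var z (\<lambda>i. \<i> * X i) i = 0" for i
    unfolding edge_var_def d sq by (simp add: algebra_simps)
  have w: "edge_var2 z X i + edge_var2 z (\<lambda>i. \<i> * X i) i \<le> 4 * (weight (z i) * (norm (z (Suc i) - z i))\<^sup>2)" for i
  proof -
    define n where "n = (norm (z (Suc i) - z i))\<^sup>2"
    define q where "q = G (z i) * X i"
    have "edge_var2 z X i + edge_var2 z (\<lambda>i. \<i> * X i) i = weight (z i) * n * (4 * (Re q)\<^sup>2 + 4 * (Re (\<i> * q))\<^sup>2
       - 2 * (Re (G' (z i) (X i) * X i) + Re (G' (z i) (\<i> * X i) * (\<i> * X i)))
       - 8 * (Re q * Re (1 + q) + Re (\<i> * q) * Re (\<i> * (1 + q))) + 4 * (norm (1 + q))\<^sup>2)"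
      unfolding edge_var2_def d sq norm_mult power_mult_distrib n_def[symmetric] q_def[symmetric] mult.left_commute[of "G (z i)" \<i>]
      by (simp add: algebra_simps)
    also have "\<dots> = weight (z i) * n * (4 - 2 * ((norm (X i))\<^sup>2 * laplacian (z i)))"
      unfolding laplacian_rotate cmod_power2 by (simp add: power2_eq_square algebra_simps)
    also have "\<dots> \<le> weight (z i) * n * 4"
      using laplacian_nonneg by (intro mult_left_mono) (auto simp: weight_def n_def)
    finally show ?thesis by (simp add: n_def)
  qed
  have E: "real N * (\<Sum>i<N. edge_var z X i) = 2 * energy N z"
    unfolding v1 energy_def by (simp add: sum_distrib_left[symmetric])
  show ?thesis
  proof (rule that)
    show "jet2 (\<lambda>t. energy N (\<lambda>i. z i + of_real t * X i)) (2 * energy N z) (real N * (\<Sum>i<N. edge_var2 z X i))"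
      using jet2_energy[of N z X] unfolding E .
    show "jet2 (\<lambda>t. energy N (\<lambda>i. z i + of_real t * (\<i> * X i))) 0 (real N * (\<Sum>i<N. edge_var2 z (\<lambda>i. \<i> * X i) i))"
      using jet2_energy[of N z "\<lambda>i. \<i> * X i"] unfolding v2 by simp
    have "(\<Sum>i<N. edge_var2 z X i) + (\<Sum>i<N. edge_var2 z (\<lambda>i. \<i> * X i) i) \<le> 4 * (\<Sum>i<N. weight (z i) * (norm (z (Suc i) - z i))\<^sup>2)"
      unfolding sum.distrib[symmetric] sum_distrib_left by (intro sum_mono w)
    then have "real N * ((\<Sum>i<N. edge_var2 z X i) + (\<Sum>i<N. edge_var2 z (\<lambda>i. \<i> * X i) i)) \<le> real N * (4 * (\<Sum>i<N. weight (z i) * (norm (z (Suc i) - z i))\<^sup>2))"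
      by (rule mult_left_mono) simp
    then show "real N * (\<Sum>i<N. edge_var2 z X i) + real N * (\<Sum>i<N. edge_var2 z (\<lambda>i. \<i> * X i) i) \<le> 4 * energy N z"
      by (simp only: energy_def distrib_left mult.left_commute)
  qed (rule E)
qed

text \<open>
  The logarithm of the density of the hyperbolic metric of \<open>|z| > 1\<close> relative to \<open>exp(-U) |dz|\<close>.
\<close>

definition log_density :: "complex \<Rightarrow> real" where
  "log_density z = U z - ln (norm z) - ln (ln (norm z))"

text \<open>
  The hyperbolic metric has curvature -1: the Laplacian of \<open>- log (log |z|)\<close> is \<open>1 / (|z| log |z|)\<^sup>2\<close>.
\<close>

lemma log_density_jets:
  assumes "1 < norm z"
  obtains p1 q1 p2 q2 where
    "jet2 (\<lambda>t. log_density (z + of_real t * X)) p1 q1"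
    "jet2 (\<lambda>t. log_density (z + of_real t * (\<i> * X))) p2 q2"
    "(norm X)\<^sup>2 / (norm z * ln (norm z))\<^sup>2 \<le> q1 + q2"
proof -
  have z: "z \<noteq> 0" using assms by auto
  have l: "0 < ln (norm z)" by (rule ln_gt_zero[OF assms])
  define k where "k = (norm X)\<^sup>2 / (norm z)\<^sup>2"
  define m where "m Y = ln_norm_deriv z Y" for Y
  define L where "L = ln (norm z)"
  have L: "0 < L" using l by (simp add: L_def)
  have m: "(m X)\<^sup>2 + (m (\<i> * X))\<^sup>2 = k" unfolding m_def k_def by (rule ln_norm_deriv_rotate[OF z])
  have jet: "jet2 (\<lambda>t. log_density (z + of_real t * Y)) (Re (G z * Y) - m Y - m Y / L) 
       (Re (G' z Y * Y) - (k - 2 * (m Y)\<^sup>2) - ((k - 2 * (m Y)\<^sup>2) / L - (m Y / L)\<^sup>2))" if "norm Y = norm X" for Y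
  proof -
    have 1: "jet2 (\<lambda>t. ln (norm (z + of_real t * Y))) (m Y) (k - 2 * (m Y)\<^sup>2)"
      using jet2_ln_norm[OF z, of Y] that by (simp add: m_def k_def)
    have 2: "jet2 (\<lambda>t. ln (ln (norm (z + of_real t * Y)))) (m Y / L) ((k - 2 * (m Y)\<^sup>2) / L - (m Y / L)\<^sup>2)"
      using jet2_ln[OF 1] l by (simp add: L_def)
    have eq: "(\<lambda>t. log_density (z + of_real t * Y)) = (\<lambda>t. U (z + of_real t * Y)
        + - 1 * ln (norm (z + of_real t * Y)) + - 1 * ln (ln (norm (z + of_real t * Y))))"
      by (simp add: log_density_def)
    show ?thesis
      unfolding eq
      by (rule jet2_cong[OF jet2_add[OF jet2_add[OF jet2_U jet2_cmult[OF 1]] jet2_cmult[OF 2]]])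
        (simp_all del: times_complex.sel)
  qed
  have "0 \<le> (norm X)\<^sup>2 * laplacian z" using laplacian_nonneg by simp
  moreover have "(k - 2 * (m X)\<^sup>2) / L + (k - 2 * (m (\<i> * X))\<^sup>2) / L = 0"
    unfolding add_divide_distrib[symmetric] using m by simp
  moreover have "(m X / L)\<^sup>2 + (m (\<i> * X) / L)\<^sup>2 = k / L\<^sup>2"
    unfolding power_divide add_divide_distrib[symmetric] m ..
  moreover have "k / L\<^sup>2 = (norm X)\<^sup>2 / (norm z * ln (norm z))\<^sup>2"
    by (simp add: k_def L_def power_mult_distrib)
  ultimately have "(norm X)\<^sup>2 / (norm z * ln (norm z))\<^sup>2 \<le> (Re (G' z X * X) - (k - 2 * (m X)\<^sup>2) - ((k - 2 * (m X)\<^sup>2) / L - (m X / L)\<^sup>2))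
    + (Re (G' z (\<i> * X) * (\<i> * X)) - (k - 2 * (m (\<i> * X))\<^sup>2) - ((k - 2 * (m (\<i> * X))\<^sup>2) / L - (m (\<i> * X) / L)\<^sup>2))"
    using m laplacian_rotate[of z X] by linarith
  then show ?thesis using that[OF jet[of X] jet[of "\<i> * X"]] by (simp add: norm_mult)
qed

text \<open>
  The competitors are all chains from the same point with energy below 1. That their end points satisfy
  \<open>|z| > 1\<close> is included, because \<open>log_density\<close> has no meaning elsewhere.
\<close>

definition maximal_chain :: "nat \<Rightarrow> (nat \<Rightarrow> complex) \<Rightarrow> bool" where
  "maximal_chain N z \<longleftrightarrow> energy N z < 1 \<and> 1 < norm (z N) \<and>
     (\<forall>y. y 0 = z 0 \<longrightarrow> energy N y < 1 \<longrightarrow> 1 < norm (y N) \<and>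
        log_density (y N) + ln (1 - energy N y) \<le> log_density (z N) + ln (1 - energy N z))"

lemma energy_nonneg: "0 \<le> energy N z"
  unfolding energy_def weight_def by (intro mult_nonneg_nonneg sum_nonneg) auto

lemma eventually_competitor:
  assumes "maximal_chain N z" "Y 0 = 0"
  shows "\<forall>\<^sub>F t in nhds 0. energy N (\<lambda>i. z i + of_real t * Y i) < 1 \<and> 
    log_density (z N + of_real t * Y N) + ln (1 - energy N (\<lambda>i. z i + of_real t * Y i)) \<le> log_density (z N) + ln (1 - energy N z)"
proof -
  define g where "g t = energy N (\<lambda>i. z i + of_real t * Y i)" for t
  have "isCont g 0"
    unfolding g_def by (rule jet2_imp_cont[OF jet2_energy])
  then have "(g \<longlongrightarrow> g 0) (nhds 0)"
    unfolding isCont_def tendsto_at_iff_tendsto_nhds .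
  moreover have "g 0 < 1" using assms(1) by (simp add: g_def maximal_chain_def)
  ultimately have "\<forall>\<^sub>F t in nhds 0. g t < 1" by (rule order_tendstoD(2))
  then show ?thesis
  proof eventually_elim
    case (elim t)
    have "log_density (y N) + ln (1 - energy N y) \<le> log_density (z N) + ln (1 - energy N z)"
      if "y 0 = z 0" "energy N y < 1" for y
      using assms(1) that unfolding maximal_chain_def by blast
    from this[of "\<lambda>i. z i + of_real t * Y i"] show ?case using elim assms(2) by (simp add: g_def)
  qed
qed

text \<open>
  The second derivative test in the directions \<open>Y\<close> and \<open>\<i> Y\<close>, added up.
\<close>

lemma maximal_chain_variation:
  assumes z: "maximal_chain N z" and Y: "Y 0 = 0"
    and j1: "jet2 (\<lambda>t. energy N (\<lambda>i. z i + of_real t * Y i)) P1 Q1"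
    and j2: "jet2 (\<lambda>t. energy N (\<lambda>i. z i + of_real t * (\<i> * Y i))) P2 Q2"
  shows "(norm (Y N))\<^sup>2 / (norm (z N) * ln (norm (z N)))\<^sup>2 \<le> (Q1 + Q2) / (1 - energy N z) + (P1\<^sup>2 + P2\<^sup>2) / (1 - energy N z)\<^sup>2"
proof -
  define E where "E = energy N z"
  have E: "0 < 1 - E" and zN: "1 < norm (z N)" using z by (auto simp: E_def maximal_chain_def)
  obtain p1 q1 p2 q2 where pq: 
    "jet2 (\<lambda>t. log_density (z N + of_real t * Y N)) p1 q1"
    "jet2 (\<lambda>t. log_density (z N + of_real t * (\<i> * Y N))) p2 q2"
    "(norm (Y N))\<^sup>2 / (norm (z N) * ln (norm (z N)))\<^sup>2 \<le> q1 + q2" using log_density_jets[OF zN] by metis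
  have "q + (- Q / (1 - E) - (- P / (1 - E))\<^sup>2) \<le> 0"
    if j: "jet2 (\<lambda>t. energy N (\<lambda>i. z i + of_real t * Y i)) P Q" 
       "jet2 (\<lambda>t. log_density (z N + of_real t * Y N)) p q" and Y: "Y 0 = 0" for Y P Q p q
  proof -
    have "jet2 (\<lambda>t. 1 - energy N (\<lambda>i. z i + of_real t * Y i)) (- P) (- Q)"
      using jet2_add[OF jet2_const[of 1] jet2_cmult[OF j(1), of "-1"]] by simp
    from jet2_add[OF j(2) jet2_ln[OF this]] E
    have "jet2 (\<lambda>t. log_density (z N + of_real t * Y N) + ln (1 - energy N (\<lambda>i. z i + of_real t * Y i)))
       (p + - P / (1 - E)) (q + (- Q / (1 - E) - (- P / (1 - E))\<^sup>2))" by (simp add: E_def)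
    then show ?thesis
    proof (rule jet2_max(2))
      show "\<forall>\<^sub>F t in nhds 0. log_density (z N + of_real t * Y N) + ln (1 - energy N (\<lambda>i. z i + of_real t * Y i))
        \<le> log_density (z N + of_real 0 * Y N) + ln (1 - energy N (\<lambda>i. z i + of_real 0 * Y i))"
        using eventually_competitor[where Y=Y, OF z Y] by eventually_elim simp
    qed
  qed
  from this[OF j1 pq(1) Y] this[OF j2 pq(2)] Y
  have "q1 + (- Q1 / (1 - E) - (- P1 / (1 - E))\<^sup>2) \<le> 0" "q2 + (- Q2 / (1 - E) - (- P2 / (1 - E))\<^sup>2) \<le> 0" by auto
  then have "q1 + q2 \<le> (Q1 + Q2) / (1 - E) + (P1\<^sup>2 + P2\<^sup>2) / (1 - E)\<^sup>2"
    by (simp add: power_divide add_divide_distrib)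
  then show ?thesis using pq(3) by (simp add: E_def)
qed

text \<open>
  With fixed end points only the energy varies, and a maximal chain minimises it.
\<close>

lemma maximal_chain_stationary:
  assumes z: "maximal_chain N z" and Y: "Y 0 = 0" "Y N = 0"
  shows "real N * (\<Sum>i<N. edge_var z Y i) = 0"
proof -
  have "jet2 (\<lambda>t. - 1 * energy N (\<lambda>i. z i + of_real t * Y i)) (- 1 * (real N * (\<Sum>i<N. edge_var z Y i))) (- 1 * (real N * (\<Sum>i<N. edge_var2 z Y i)))"
    by (rule jet2_cmult[OF jet2_energy])
  then have "- 1 * (real N * (\<Sum>i<N. edge_var z Y i)) = 0"
  proof (rule jet2_max(1))
    show "\<forall>\<^sub>F t in nhds 0. - 1 * energy N (\<lambda>i. z i + of_real t * Y i) \<le> - 1 * energy N (\<lambda>i. z i + of_real 0 * Y i)"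
      using eventually_competitor[where Y=Y, OF z Y(1)]
    proof eventually_elim
      case (elim t)
      then have "ln (1 - energy N (\<lambda>i. z i + of_real t * Y i)) \<le> ln (1 - energy N z)" using Y(2) by simp
      then show ?case using elim z by (simp add: maximal_chain_def)
    qed
  qed
  then show ?thesis by simp
qed

lemma stationary_at_vertex:
  assumes z: "maximal_chain N z" and i: "Suc i < N"
  shows "Re (- 2 * of_real (weight (z (Suc i))) * G (z (Suc i)) * V) * (norm (z (Suc (Suc i)) - z (Suc i)))\<^sup>2
    - 2 * weight (z (Suc i)) * Re (cnj (z (Suc (Suc i)) - z (Suc i)) * V) + 2 * weight (z i) * Re (cnj (z (Suc i) - z i) * V) = 0"
proof -
  define Y where "Y j = (if j = Suc i then V else 0)" for j
  have "(\<Sum>j<N. edge_var z Y j) = (\<Sum>j\<in>{i, Suc i}. edge_var z Y j)"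
    using i by (intro sum.mono_neutral_right) (auto simp: edge_var_def Y_def)
  moreover have "(\<Sum>j<N. edge_var z Y j) = 0"
    using maximal_chain_stationary[of N z Y, OF z] i by (simp add: Y_def)
  ultimately have "edge_var z Y i + edge_var z Y (Suc i) = 0" by simp
  then show ?thesis by (simp add: edge_var_def Y_def algebra_simps)
qed

text \<open>
  A variation is the sum of one with fixed end points, along which the energy is stationary, and of one
  that moves only the last vertex.
\<close>

lemma end_variation:
  assumes z: "maximal_chain N z" and X: "X 0 = 0" and N: "0 < N"
  shows "real N * (\<Sum>i<N. edge_var z X i) = real N * (2 * weight (z (N-1)) * Re (cnj (z N - z (N-1)) * X N))"
proof -
  define Y where "Y i = (if i = N then 0 else X i)" for i
  \<comment> \<open>\<open>X\<close> is split into a part with fixed end points and a motion of the last vertex\<close>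
  define Y' where "Y' i = (if i = N then X N else 0)" for i
  have XY: "X = (\<lambda>i. Y i + Y' i)" by (auto simp: Y_def Y'_def)
  have "real N * (\<Sum>i<N. edge_var z Y i) = 0"
    using maximal_chain_stationary[of N z Y, OF z] N X by (simp add: Y_def)
  moreover have "(\<Sum>i<N. edge_var z Y' i) = (\<Sum>i\<in>{N-1}. edge_var z Y' i)"
    using N by (intro sum.mono_neutral_right) (auto simp: edge_var_def Y'_def)
  then have "(\<Sum>i<N. edge_var z Y' i) = 2 * weight (z (N-1)) * Re (cnj (z N - z (N-1)) * X N)"
    using N by (simp add: edge_var_def Y'_def)
  moreover have "(\<Sum>i<N. edge_var z X i) = (\<Sum>i<N. edge_var z Y i) + (\<Sum>i<N. edge_var z Y' i)"
    unfolding XY edge_var_add sum.distrib ..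
  ultimately show ?thesis by (simp add: distrib_left)
qed

text \<open>
  Chains in \<open>K\<close> form a compact set by Tychonoff's theorem. The exponential of the functional is maximised, since
  it is continuous up to energy 1. The constant chain \<open>w\<close> has energy 0, which gives the last claim.
\<close>

lemma maximal_chain_exists:
  assumes K: "compact K" "\<And>z. z \<in> K \<Longrightarrow> 1 < norm z" and w: "w \<in> K"
    and conf: "\<And>z i. z 0 = w \<Longrightarrow> energy N z < 1 \<Longrightarrow> i \<le> N \<Longrightarrow> z i \<in> K"
  obtains z where "z 0 = w" "maximal_chain N z" "log_density w \<le> log_density (z N) + ln (1 - energy N z)"
proof -
  define \<Phi> where "\<Phi> z = exp (log_density (z N)) * (1 - energy N z)" for z
  define S where "S = PiE UNIV (\<lambda>i::nat. if i = 0 then {w} else K)"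
  have "compactin (product_topology (\<lambda>i::nat. euclidean :: complex topology) UNIV) S"
    unfolding S_def by (subst compactin_PiE) (use K in auto)
  then have S: "compact S" by (simp add: euclidean_product_topology)
  have cw: "(\<lambda>_. w) \<in> S" using w by (auto simp: S_def)
  have SK: "z i \<in> K" "z 0 = w" if "z \<in> S" for z i using that w by (auto simp: S_def PiE_iff split: if_splits)
  have co: "continuous_on S (\<lambda>z. z i)" for i by (rule continuous_on_product_coordinates[THEN continuous_on_subset]) auto
  have nz: "norm (y N) \<noteq> 0" "ln (norm (y N)) \<noteq> 0" if "y \<in> S" for y
    using K(2)[OF SK(1)[OF that, of N]] ln_gt_zero[of "norm (y N)"] by auto
  have "continuous_on S \<Phi>"
    unfolding \<Phi>_def energy_def weight_def log_density_def
    by (intro continuous_intros continuous_on_compose2[OF continuous_U[of UNIV] co] co)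
      (use nz in auto)
  then obtain z where z: "z \<in> S" "\<And>y. y \<in> S \<Longrightarrow> \<Phi> y \<le> \<Phi> z" using continuous_attains_sup[OF S] cw by blast
  have "energy N (\<lambda>_. w) = 0" by (simp add: energy_def)
  then have \<Phi>w: "exp (log_density w) \<le> \<Phi> z" using z(2)[OF cw] by (simp add: \<Phi>_def)
  have E: "energy N z < 1"
  proof (rule ccontr)
    assume "\<not> ?thesis"
    then have "\<Phi> z \<le> 0" by (simp add: \<Phi>_def mult_le_0_iff)
    then show False using \<Phi>w exp_gt_zero[of "log_density w"] by linarith
  qed
  have ln: "ln (exp a * (1 - b)) = a + ln (1 - b)" if "b < 1" for a b :: real
    using that by (simp add: ln_mult)
  have "1 < norm (y N) \<and> log_density (y N) + ln (1 - energy N y) \<le> log_density (z N) + ln (1 - energy N z)"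
    if y: "y 0 = w" "energy N y < 1" for y
  proof -
    define y' where "y' i = (if i \<le> N then y i else w)" for i
    have e: "energy N y' = energy N y" unfolding energy_def y'_def by (intro arg_cong2[where f="(*)"] sum.cong) auto
    have "y' \<in> S" using conf[OF y] w y by (auto simp: S_def y'_def)
    then have "\<Phi> y' \<le> \<Phi> z" by (rule z)
    then have "exp (log_density (y N)) * (1 - energy N y) \<le> exp (log_density (z N)) * (1 - energy N z)"
      by (simp add: \<Phi>_def e) (simp add: y'_def)
    then have "ln (exp (log_density (y N)) * (1 - energy N y)) \<le> ln (exp (log_density (z N)) * (1 - energy N z))"
      using y(2) by (intro ln_mono) auto
    then show ?thesis using K(2)[OF conf[OF y order_refl]] E y(2) by (simp add: ln)
  qed
  moreover have "log_density w \<le> log_density (z N) + ln (1 - energy N z)"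
  proof -
    have "ln (exp (log_density w)) \<le> ln (\<Phi> z)" using \<Phi>w by (intro ln_mono) auto
    then show ?thesis using E by (simp add: \<Phi>_def ln)
  qed
  ultimately show ?thesis
    using that[of z] E K(2)[OF SK(1)[OF z(1)]] SK(2)[OF z(1)] by (simp add: maximal_chain_def)
qed

end

section \<open>The Ahlfors--Schwarz estimate\<close>

context subharmonic_C2 begin

lemma weight_pos: "0 < weight z"
  by (simp add: weight_def)

text \<open>
  The weight \<open>exp(-2 U)\<close> is itself of class C2, so that \<open>taylor_bound\<close> applies to it.
\<close>

lemma weight_C2: "C2_plane weight (\<lambda>z. - 2 * of_real (weight z) * G z)
  (\<lambda>z h. - 2 * (of_real (weight z) * G' z h + of_real (- 2 * weight z * Re (G z * h)) * G z))"
proof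
  have w: "(weight has_derivative (\<lambda>h. - 2 * weight z * Re (G z * h))) (at z)" for z
    unfolding weight_def by (auto intro!: derivative_eq_intros U_deriv simp: algebra_simps)
  then show "(weight has_derivative (\<lambda>h. Re (- 2 * of_real (weight z) * G z * h))) (at z)" for z
    by (rule has_derivative_eq_rhs) (simp add: fun_eq_iff algebra_simps)
  show "((\<lambda>z. - 2 * of_real (weight z) * G z) has_derivative
     (\<lambda>h. - 2 * (of_real (weight z) * G' z h + of_real (- 2 * weight z * Re (G z * h)) * G z))) (at z)" for z
    using has_derivative_mult_right[OF has_derivative_mult[OF has_derivative_of_real[OF w] G_deriv], of "-2"] 
    by (simp add: mult.assoc)
  have cw: "continuous_on UNIV weight" unfolding weight_def by (intro continuous_intros continuous_U)
  show "continuous_on UNIV (\<lambda>z. - 2 * (of_real (weight z) * G' z 1 + of_real (- 2 * weight z * Re (G z * 1)) * G z))"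
    "continuous_on UNIV (\<lambda>z. - 2 * (of_real (weight z) * G' z \<i> + of_real (- 2 * weight z * Re (G z * \<i>)) * G z))"
    by (intro continuous_intros cw G'_cont continuous_G)+
qed

text \<open>
  The second variation along the balanced field \<open>X\<close> bounds \<open>|X\<^sub>N|\<^sup>2 \<mu>\<^sup>2\<close> by \<open>4 E / (1 - E)\<^sup>2\<close>, where
  \<open>\<mu>\<close> is the hyperbolic density at \<open>z\<^sub>N\<close> and \<open>E\<close> the energy. The first variation, together with the bound on
  the last step, bounds \<open>E\<close> by \<open>4 exp(-2 U(z\<^sub>N)) |X\<^sub>N|\<^sup>2\<close>. The factor \<open>|X\<^sub>N|\<^sup>2\<close> cancels.
\<close>

lemma density_bound_nonconstant:
  fixes A :: real
  assumes z: "maximal_chain N z" and A: "1 \<le> A" "16 * A^5 \<le> real N"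
    and low: "\<And>i. i \<le> N \<Longrightarrow> 1 \<le> A * weight (z i)"
    and lip: "\<And>i j. i \<le> N \<Longrightarrow> j \<le> N \<Longrightarrow> \<bar>weight (z i) - weight (z j)\<bar> \<le> A * norm (z i - z j)"
    and tay: "\<And>i j. i \<le> N \<Longrightarrow> j \<le> N \<Longrightarrow> 
       \<bar>weight (z j) - weight (z i) - Re (- 2 * of_real (weight (z i)) * G (z i) * (z j - z i))\<bar> \<le> A * (norm (z j - z i))\<^sup>2"
    and grad: "\<And>i. i \<le> N \<Longrightarrow> norm (- 2 * of_real (weight (z i)) * G (z i)) \<le> A"
    and E0: "0 < energy N z"
  shows "exp (log_density (z N)) * (1 - energy N z) \<le> 4"
proof -
  define e where "e i = weight (z i) * (norm (z (Suc i) - z i))\<^sup>2" for i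
  define E where "E = energy N z"
  have A5: "1 \<le> A^5" using A(1) by simp
  then have "0 < real N" using A(2) by linarith
  then have N: "0 < N" by simp
  have E: "E = real N * (\<Sum>i<N. e i)" by (simp add: E_def energy_def e_def)
  have E1: "E < 1" "0 < E" using z E0 by (auto simp: E_def maximal_chain_def)
  have e0: "0 \<le> e i" for i using weight_pos[of "z i"] by (simp add: e_def)
  have "real N * e (N - 1) \<le> 2 * (\<Sum>i<N. e i)"
  proof (rule last_term_le_twice_average[OF e0 N, where C="2 * A^5"])
    fix i assume i: "Suc i < N"
    show "\<bar>e (Suc i) - e i\<bar> \<le> 2 * A^5 * (e (Suc i) + e i)\<^sup>2"
      unfolding e_def
    proof (rule edge_change[where \<Gamma>="- 2 * of_real (weight (z (Suc i))) * G (z (Suc i))", OF stationary_at_vertex[OF z i]])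
      show "\<bar>weight (z i) - weight (z (Suc i)) + Re (- 2 * of_real (weight (z (Suc i))) * G (z (Suc i)) * (z (Suc i) - z i))\<bar>
        \<le> A * (norm (z (Suc i) - z i))\<^sup>2"
        using tay[of "Suc i" i] i by (simp add: norm_minus_commute[of "z i"] algebra_simps)
      show "\<bar>weight (z i) - weight (z (Suc i))\<bar> \<le> A * norm (z (Suc i) - z i)"
        using lip[of i "Suc i"] i by (simp add: norm_minus_commute)
    qed (use i A(1) low grad in \<open>auto simp del: times_complex.sel\<close>)
  next
    have "(\<Sum>i<N. e i) \<le> 1 / real N" using E1 N unfolding E by (simp add: field_simps)
    then have "8 * (2 * A^5) * (\<Sum>i<N. e i) \<le> 8 * (2 * A^5) * (1 / real N)" using A5 A(1) by (intro mult_left_mono) auto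
    also have "\<dots> \<le> 1" using A(2) A5 N by (simp add: field_simps)
    finally show "8 * (2 * A^5) * (\<Sum>i<N. e i) \<le> 1" .
  qed (use A(1) in simp)
  then have last: "real N * (real N * e (N - 1)) \<le> 2 * E"
    using mult_left_mono[of "real N * e (N-1)" "2 * (\<Sum>i<N. e i)" "real N"] by (simp add: E)
  \<comment> \<open>the last step is so short that the weight at its start is at most twice the weight at its end\<close>
  have wN: "weight (z (N-1)) \<le> 2 * weight (z N)"
  proof -
    define D where "D = norm (z N - z (N-1))"
    have "real N * (A * e (N-1)) \<le> A * E" 
      unfolding E using member_le_sum[of "N-1" "{..<N}" e] e0 N A(1) by (simp add: mult.left_commute mult_left_mono)
    also have "\<dots> \<le> A" using E1 A(1) by simp
    finally have "real N * (A * e (N-1)) \<le> A" .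
    moreover have "D\<^sup>2 \<le> A * e (N-1)" using mult_right_mono[OF low[of "N-1"], of "D\<^sup>2"] N by (simp add: e_def D_def mult.assoc)
    ultimately have "real N * D\<^sup>2 \<le> A" using N by (meson mult_left_mono of_nat_0_le_iff order_trans)
    have "(A^5) * (D\<^sup>2) \<le> real N * D\<^sup>2" using A(2) A5 by (intro mult_right_mono) auto
    then have "A^5 * D\<^sup>2 \<le> A" using \<open>real N * D\<^sup>2 \<le> A\<close> by simp
    then have "A * (A\<^sup>2 * D)\<^sup>2 \<le> A * 1" by (simp add: power_mult_distrib power_mult[symmetric] eval_nat_numeral mult_ac)
    then have "(A\<^sup>2 * D)\<^sup>2 \<le> 1\<^sup>2" using A(1) by (subst (asm) mult_le_cancel_left_pos) auto
    then have "A\<^sup>2 * D \<le> 1" by (rule power2_le_imp_le) simp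
    also have "1 \<le> A * weight (z N)" using low[of N] by simp
    finally have "A * (A * D) \<le> A * weight (z N)" by (simp add: power2_eq_square mult.assoc)
    then have "A * D \<le> weight (z N)" using A(1) by (subst (asm) mult_le_cancel_left_pos) auto
    moreover have "\<bar>weight (z (N-1)) - weight (z N)\<bar> \<le> A * D" using lip[of "N-1" N] by (simp add: D_def norm_minus_commute)
    ultimately show ?thesis by linarith
  qed
  define X where "X = rec_nat 0 (\<lambda>i x. x + (z (Suc i) - z i) * (1 + G (z i) * x))"
  have X: "X 0 = 0" "\<And>i. X (Suc i) = X i + (z (Suc i) - z i) * (1 + G (z i) * X i)" by (simp_all add: X_def)
  obtain Q1 Q2 where Q: "jet2 (\<lambda>t. energy N (\<lambda>i. z i + of_real t * X i)) (2 * E) Q1"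
    "jet2 (\<lambda>t. energy N (\<lambda>i. z i + of_real t * (\<i> * X i))) 0 Q2"
    "Q1 + Q2 \<le> 4 * E" "real N * (\<Sum>i<N. edge_var z X i) = 2 * E"
    unfolding E_def by (rule balanced_energy_jets[of X z N, OF X(2)])
  define x where "x = norm (X N)"
  define \<mu> where "\<mu> = 1 / (norm (z N) * ln (norm (z N)))"
  have zN: "1 < norm (z N)" using z by (simp add: maximal_chain_def)
  have "x\<^sup>2 * \<mu>\<^sup>2 \<le> (Q1 + Q2) / (1 - E) + ((2 * E)\<^sup>2 + 0\<^sup>2) / (1 - E)\<^sup>2"
    using maximal_chain_variation[of N z X, OF z X(1) Q(1,2)] by (simp add: x_def \<mu>_def E_def power_divide)
  also have "\<dots> \<le> 4 * E / (1 - E) + (2 * E)\<^sup>2 / (1 - E)\<^sup>2"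
    using Q(3) E1 by (simp add: divide_right_mono)
  also have "4 * E / (1 - E) = 4 * E * (1 - E) / (1 - E)\<^sup>2"
    using E1 by (simp add: power2_eq_square)
  also have "4 * E * (1 - E) / (1 - E)\<^sup>2 + (2 * E)\<^sup>2 / (1 - E)\<^sup>2 = 4 * E / (1 - E)\<^sup>2"
    unfolding add_divide_distrib[symmetric] by (simp add: power2_eq_square algebra_simps)
  finally have up: "x\<^sup>2 * \<mu>\<^sup>2 \<le> 4 * E / (1 - E)\<^sup>2" .
  have "E = real N * weight (z (N-1)) * Re (cnj (z N - z (N-1)) * X N)"
    using end_variation[of N z X, OF z X(1) N] Q(4) by simp
  also have "\<dots> \<le> real N * weight (z (N-1)) * (norm (z N - z (N-1)) * x)"
    using weight_pos[of "z (N-1)"] complex_Re_le_cmod[of "cnj (z N - z (N-1)) * X N"]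
    by (intro mult_left_mono) (auto simp: norm_mult x_def simp del: times_complex.sel complex_cnj_diff)
  finally have "E\<^sup>2 \<le> (real N * weight (z (N-1)) * (norm (z N - z (N-1)) * x))\<^sup>2"
    using E1 by (intro power_mono) auto
  also have "\<dots> = real N * (real N * e (N-1)) * (weight (z (N-1)) * x\<^sup>2)"
    using N by (simp add: e_def power2_eq_square algebra_simps)
  also have "\<dots> \<le> (2 * E) * (weight (z (N-1)) * x\<^sup>2)"
    using last weight_pos[of "z (N-1)"] by (intro mult_right_mono) auto
  also have "\<dots> \<le> (2 * E) * (2 * weight (z N) * x\<^sup>2)"
    using wN E1 by (intro mult_left_mono mult_right_mono) auto
  also have "\<dots> = E * (4 * weight (z N) * x\<^sup>2)" by algebra
  finally have "E * E \<le> E * (4 * weight (z N) * x\<^sup>2)" unfolding power2_eq_square[of E] .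
  then have Ex: "E \<le> 4 * weight (z N) * x\<^sup>2" using E1 by (subst (asm) mult_le_cancel_left_pos) auto
  then have x0: "0 < x\<^sup>2" using E1 by (cases "x = 0") auto
  have "x\<^sup>2 * \<mu>\<^sup>2 \<le> x\<^sup>2 * (16 * weight (z N) / (1 - E)\<^sup>2)"
    using up Ex E1 by (intro order_trans[OF up]) (simp add: divide_right_mono)
  then have "\<mu>\<^sup>2 \<le> 16 * weight (z N) / (1 - E)\<^sup>2" using x0 by (subst (asm) mult_le_cancel_left_pos) auto
  then have "\<mu>\<^sup>2 * (1 - E)\<^sup>2 \<le> 16 * weight (z N)" using E1 by (simp add: field_simps)
  then have "(exp (U (z N)))\<^sup>2 * (\<mu>\<^sup>2 * (1 - E)\<^sup>2) \<le> (exp (U (z N)))\<^sup>2 * (16 * weight (z N))" by (intro mult_left_mono) auto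
  also have "\<dots> = 4\<^sup>2" by (simp add: weight_def power2_eq_square flip: exp_add)
  finally have "(exp (U (z N)) * \<mu> * (1 - E))\<^sup>2 \<le> 4\<^sup>2" by (simp add: power_mult_distrib mult.assoc)
  then have "exp (U (z N)) * \<mu> * (1 - E) \<le> 4" by (rule power2_le_imp_le) simp
  moreover have "exp (log_density (z N)) = exp (U (z N)) * \<mu>"
    using zN ln_gt_zero[OF zN] by (cases "z N = 0") (simp_all add: log_density_def \<mu>_def exp_diff)
  ultimately show ?thesis by (simp add: E_def)
qed

text \<open>
  For a chain that does not move, the balanced field vanishes. It is replaced by the field that grows linearly from 0 to
  1 along the chain; the energy along it is \<open>exp(-2 U) t\<^sup>2\<close> up to higher order terms.
\<close>

lemma density_bound_constant:
  assumes z: "maximal_chain N z" and N: "0 < N" and E0: "energy N z = 0"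
  shows "exp (log_density (z N)) \<le> 4"
proof -
  have sum0: "(\<Sum>i<N. weight (z i) * (norm (z (Suc i) - z i))\<^sup>2) = 0" using E0 N by (simp add: energy_def)
  have D0: "z (Suc i) = z i" if "i < N" for i
  proof -
    have "weight (z i) * (norm (z (Suc i) - z i))\<^sup>2 = 0"
      using sum0 that weight_pos by (subst (asm) sum_nonneg_eq_0_iff) (auto simp: less_imp_le)
    then show ?thesis using weight_pos[of "z i"] by simp
  qed
  have const: "z i = z N" if "i \<le> N" for i
    using that
  proof (induction rule: inc_induct)
    case (step n)
    then show ?case using D0[of n] by metis
  qed (rule refl)
  define X where "X i = complex_of_real (real i / real N)" for i
  have X0: "X 0 = 0" and XN: "X N = 1" using N by (simp_all add: X_def)
  have "X (Suc i) - X i = of_real (real (Suc i) / real N - real i / real N)" for i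
    by (simp only: X_def of_real_diff)
  moreover have "real (Suc i) / real N - real i / real N = 1 / real N" for i
    by (simp add: add_divide_distrib)
  ultimately have "X (Suc i) - X i = of_real (1 / real N)" for i by (simp only:)
  then have dX: "norm (X (Suc i) - X i) = 1 / real N" for i
    by (simp only: norm_of_real) simp
  have idX: "norm (\<i> * X (Suc i) - \<i> * X i) = 1 / real N" for i
    using dX[of i] by (simp only: right_diff_distrib[symmetric] norm_mult norm_ii)
  have j: "jet2 (\<lambda>t. energy N (\<lambda>i. z i + of_real t * Y i)) 0 (2 * weight (z N))"
    if Y: "\<And>i. norm (Y (Suc i) - Y i) = 1 / real N" for Y
  proof (rule jet2_cong[OF jet2_energy])
    have "edge_var z Y i = 0" "edge_var2 z Y i = 2 * weight (z N) / (real N)\<^sup>2" if "i < N" for i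
      using that by (simp_all add: edge_var_def edge_var2_def D0 Y const[of i] power_divide)
    then show "real N * (\<Sum>i<N. edge_var z Y i) = 0" "real N * (\<Sum>i<N. edge_var2 z Y i) = 2 * weight (z N)"
      using N by (simp_all add: power2_eq_square)
  qed
  have "(norm (X N))\<^sup>2 / (norm (z N) * ln (norm (z N)))\<^sup>2 \<le> (2 * weight (z N) + 2 * weight (z N)) / (1 - energy N z) + (0\<^sup>2 + 0\<^sup>2) / (1 - energy N z)\<^sup>2"
    by (rule maximal_chain_variation[of N z X, OF z X0 j[of X, OF dX] j[of "\<lambda>i. \<i> * X i", OF idX]])
  then have le: "1 / (norm (z N) * ln (norm (z N)))\<^sup>2 \<le> 4 * weight (z N)" using E0 XN by simp
  have zN: "1 < norm (z N)" using z by (simp add: maximal_chain_def)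
  then have ed: "exp (log_density (z N)) = exp (U (z N)) * (1 / (norm (z N) * ln (norm (z N))))"
    using ln_gt_zero[OF zN] by (cases "z N = 0") (simp_all add: log_density_def exp_diff)
  have "(exp (log_density (z N)))\<^sup>2 \<le> (exp (U (z N)))\<^sup>2 * (4 * weight (z N))"
    unfolding ed power_mult_distrib[of "exp _"] power_one_over by (intro mult_left_mono le) simp
  also have "\<dots> = 4" by (simp add: weight_def power2_eq_square flip: exp_add)
  also have "\<dots> \<le> 4\<^sup>2" by simp
  finally show ?thesis by (rule power2_le_imp_le) simp
qed

text \<open>
  Everything is independent of \<open>N\<close> except the constant \<open>A\<close>, which depends only on \<open>K\<close>; so \<open>N\<close> can be chosen
  after it.
\<close>

theorem discrete_ahlfors:
  assumes K: "compact K" "\<And>z. z \<in> K \<Longrightarrow> 1 < norm z" and w: "w \<in> K"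
    and conf: "\<And>N z i. N0 \<le> N \<Longrightarrow> z 0 = w \<Longrightarrow> energy N z < 1 \<Longrightarrow> i \<le> N \<Longrightarrow> z i \<in> K"
  shows "exp (log_density w) \<le> 4"
proof -
  interpret weight: C2_plane weight "\<lambda>z. - 2 * of_real (weight z) * G z"
    "\<lambda>z h. - 2 * (of_real (weight z) * G' z h + of_real (- 2 * weight z * Re (G z * h)) * G z)"
    by (rule weight_C2)
  obtain r where r: "0 < r" "\<And>z. z \<in> K \<Longrightarrow> norm z \<le> r"
    using compact_imp_bounded[OF K(1)] unfolding bounded_pos by blast
  obtain B where B: "0 < B" "\<And>x y. norm x \<le> r \<Longrightarrow> norm y \<le> r \<Longrightarrow>
      \<bar>weight y - weight x - Re (- 2 * of_real (weight x) * G x * (y - x))\<bar> \<le> B * (norm (y - x))\<^sup>2"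
    "\<And>x. norm x \<le> r \<Longrightarrow> norm (- 2 * of_real (weight x) * G x) \<le> B"
    using weight.taylor_bound[of r] by blast
  have "compact (U ` K)" by (intro compact_continuous_image continuous_U K)
  then have "bounded (U ` K)" by (rule compact_imp_bounded)
  then obtain M where "\<forall>v\<in>U ` K. norm v \<le> M" unfolding bounded_iff by blast
  then have M: "\<And>z. z \<in> K \<Longrightarrow> \<bar>U z\<bar> \<le> M" by simp
  \<comment> \<open>\<open>B (1 + 2 r)\<close> is a Lipschitz constant of the weight on \<open>K\<close>, whose diameter is at most \<open>2 r\<close>\<close>
  define A where "A = max (max 1 (exp (2 * M))) (B * (1 + 2 * r))"
  have A: "1 \<le> A" "exp (2 * M) \<le> A" "B * (1 + 2 * r) \<le> A" by (auto simp: A_def)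
  have "B * 1 \<le> B * (1 + 2 * r)" using B(1) r(1) by (intro mult_left_mono) auto
  then have BA: "B \<le> A" using A by simp
  have low: "1 \<le> A * weight z" if "z \<in> K" for z
  proof -
    have "1 = exp (2 * U z) * weight z" by (simp add: weight_def flip: exp_add)
    also have "\<dots> \<le> A * weight z" using A(2) M[OF that] weight_pos[of z]
      by (intro mult_right_mono) (auto intro: order_trans[of _ "exp (2 * M)"])
    finally show ?thesis .
  qed
  have lip: "\<bar>weight x - weight y\<bar> \<le> A * norm (x - y)" if "x \<in> K" "y \<in> K" for x y
  proof -
    have n: "norm (x - y) \<le> 2 * r" using norm_triangle_ineq4[of x y] r(2)[OF that(1)] r(2)[OF that(2)] by simp
    have "\<bar>weight x - weight y\<bar> \<le> B * (norm (x - y))\<^sup>2 + \<bar>Re (- 2 * of_real (weight y) * G y * (x - y))\<bar>"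
      using B(2)[OF r(2)[OF that(2)] r(2)[OF that(1)]] by linarith
    also have "\<dots> \<le> B * norm (x - y) * (2 * r) + B * norm (x - y)"
    proof (rule add_mono)
      have "B * norm (x - y) * norm (x - y) \<le> B * norm (x - y) * (2 * r)" using B(1) n by (intro mult_left_mono) auto
      then show "B * (norm (x - y))\<^sup>2 \<le> B * norm (x - y) * (2 * r)" by (simp add: power2_eq_square mult.assoc)
      have "\<bar>Re (- 2 * of_real (weight y) * G y * (x - y))\<bar> \<le> norm (- 2 * of_real (weight y) * G y * (x - y))" by (rule abs_Re_le_cmod)
      also have "\<dots> = norm (- 2 * of_real (weight y) * G y) * norm (x - y)" by (rule norm_mult)
      also have "\<dots> \<le> B * norm (x - y)" using B(3)[OF r(2)[OF that(2)]] by (intro mult_right_mono) auto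
      finally show "\<bar>Re (- 2 * of_real (weight y) * G y * (x - y))\<bar> \<le> B * norm (x - y)" .
    qed
    also have "\<dots> = B * (1 + 2 * r) * norm (x - y)" by (simp add: algebra_simps)
    also have "\<dots> \<le> A * norm (x - y)" using A(3) by (intro mult_right_mono) auto
    finally show ?thesis .
  qed
  obtain N1 :: nat where "16 * A^5 \<le> real N1" using real_arch_simple by blast
  define N where "N = max N0 (max 1 N1)"
  have N: "N0 \<le> N" "0 < N" "16 * A^5 \<le> real N" using \<open>16 * A^5 \<le> real N1\<close> by (auto simp: N_def)
  obtain z where z: "z 0 = w" "maximal_chain N z" "log_density w \<le> log_density (z N) + ln (1 - energy N z)"
    using maximal_chain_exists[OF K w, of N] conf[OF N(1)] by blast
  have zK: "z i \<in> K" if "i \<le> N" for i using conf[of N z i, OF N(1) z(1)] z(2) that by (simp add: maximal_chain_def)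
  have E1: "energy N z < 1" using z(2) by (simp add: maximal_chain_def)
  have "exp (log_density w) \<le> exp (log_density (z N) + ln (1 - energy N z))" using z(3) by simp
  also have "\<dots> = exp (log_density (z N)) * (1 - energy N z)" using E1 by (simp add: exp_add)
  also have "\<dots> \<le> 4"
  proof (cases "energy N z = 0")
    case True
    then show ?thesis using density_bound_constant[OF z(2) N(2)] by simp
  next
    case False
    show ?thesis
    proof (rule density_bound_nonconstant[OF z(2) A(1) N(3)])
      show "\<bar>weight (z j) - weight (z i) - Re (- 2 * of_real (weight (z i)) * G (z i) * (z j - z i))\<bar> \<le> A * (norm (z j - z i))\<^sup>2"
        if "i \<le> N" "j \<le> N" for i j
        using B(2)[OF r(2)[OF zK[OF that(1)]] r(2)[OF zK[OF that(2)]]] mult_right_mono[OF BA, of "(norm (z j - z i))\<^sup>2"]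
        by simp
      show "norm (- 2 * of_real (weight (z i)) * G (z i)) \<le> A" if "i \<le> N" for i
        using B(3)[OF r(2)[OF zK[OF that]]] BA by (rule order_trans)
      show "0 < energy N z" using False energy_nonneg[of N z] by simp
    qed (use low lip zK in auto)
  qed
  finally show ?thesis .
qed

end

section \<open>Completeness and logarithmic growth\<close>

definition plane :: "complex \<Rightarrow> real^2" where
  "plane z = vector [Re z, Im z]"

lemma plane_nth [simp]: "plane z $ 1 = Re z" "plane z $ 2 = Im z"
  by (simp_all add: plane_def)

lemma plane_eq: "plane z = Re z *\<^sub>R axis 1 1 + Im z *\<^sub>R axis 2 1"
  by (simp add: vec_eq_iff forall_2 axis_def)

lemma bounded_linear_plane: "bounded_linear plane"
proof -
  have "bounded_linear (\<lambda>z. Re z *\<^sub>R axis 1 1 + Im z *\<^sub>R axis 2 1 :: real^2)"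
    by (intro bounded_linear_add bounded_linear_scaleR_left[THEN bounded_linear_compose] bounded_linear_Re bounded_linear_Im)
  then show ?thesis by (simp add: plane_eq[abs_def])
qed

lemma norm_plane [simp]: "norm (plane z) = norm z"
  by (simp add: norm_vec_def L2_set_def sum_2 cmod_def)

lemma plane_diff: "plane z - plane w = plane (z - w)"
  by (simp add: vec_eq_iff forall_2)

lemma dist_plane [simp]: "dist (plane z) (plane w) = dist z w"
  by (simp add: dist_norm plane_diff)

lemma plane_surj: obtains z where "x = plane z"
proof
  show "x = plane (Complex (x $ 1) (x $ 2))" by (simp add: vec_eq_iff forall_2)
qed

lemma circle_point_plane: "circle_point (plane z) r t = plane (z + of_real r * cis t)"
  by (simp add: circle_point_def vec_eq_iff forall_2)

lemma subharmonic_C2_of_smooth: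
  assumes smooth: "smooth_function u" and sub: "subharmonic u"
  obtains G G' where "subharmonic_C2 (u \<circ> plane) G G'"
proof -
  define e1 e2 :: "real^2" where "e1 = axis 1 1" and "e2 = axis 2 1"
  have basis: "e1 \<in> Basis" "e2 \<in> Basis" by (auto simp: e1_def e2_def Basis_vec_def)
  define p where "p b x = frechet_derivative u (at x) b" for b x
  have C: "C_k_function (Suc (Suc 0)) u" using smooth unfolding smooth_function_def by blast
  have u: "u differentiable (at x)" for x using C by simp
  have p: "p b differentiable (at x)" "continuous_on UNIV (\<lambda>x. frechet_derivative (p b) (at x) c)" 
    if "b \<in> Basis" "c \<in> Basis" for b c x
    using C that unfolding p_def by auto
  have lin: "f' (plane h) = Re h * f' e1 + Im h * f' e2" if "(f has_derivative f') (at x)" for f :: "real^2 \<Rightarrow> real" and f' x h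
  proof -
    interpret bounded_linear f' using that by (rule has_derivative_bounded_linear)
    show ?thesis by (simp add: plane_eq add scaleR e1_def e2_def)
  qed
  have plane: "((\<lambda>z. plane z) has_derivative plane) (at z)" for z
    by (rule bounded_linear_imp_has_derivative[OF bounded_linear_plane])
  have comp: "((\<lambda>z. f (plane z)) has_derivative (\<lambda>h. Re h * frechet_derivative f (at (plane z)) e1 + Im h * frechet_derivative f (at (plane z)) e2)) (at z)"
    if "f differentiable (at (plane z))" for f :: "real^2 \<Rightarrow> real" and z
  proof -
    have f: "(f has_derivative frechet_derivative f (at (plane z))) (at (plane z))"
      using that frechet_derivative_works by blast
    show ?thesis
      using has_derivative_compose[OF plane f] unfolding lin[OF f] .
  qed
  define G where "G z = of_real (p e1 (plane z)) - \<i> * of_real (p e2 (plane z))" for z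
  define q where "q b z h = Re h * frechet_derivative (p b) (at (plane z)) e1 + Im h * frechet_derivative (p b) (at (plane z)) e2" for b z h
  define G' where "G' z h = of_real (q e1 z h) - \<i> * of_real (q e2 z h)" for z h
  have cq: "continuous_on UNIV (\<lambda>z. q b z h)" if "b \<in> Basis" for b h
    unfolding q_def
    by (intro continuous_intros continuous_on_compose2[OF p(2)[OF that basis(1)]] continuous_on_compose2[OF p(2)[OF that basis(2)]]
        linear_continuous_on[OF bounded_linear_plane]) auto
  interpret C2_plane "u \<circ> plane" G G'
  proof
    show "((u \<circ> plane) has_derivative (\<lambda>h. Re (G z * h))) (at z)" for z
      unfolding o_def by (rule has_derivative_eq_rhs[OF comp[OF u]]) (simp add: G_def p_def fun_eq_iff)
    show "(G has_derivative G' z) (at z)" for z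
      unfolding G_def G'_def q_def
      by (intro has_derivative_diff has_derivative_mult_right has_derivative_of_real comp p(1)[OF basis(1,1)] p(1)[OF basis(2,1)])
    show "continuous_on UNIV (\<lambda>z. G' z 1)" "continuous_on UNIV (\<lambda>z. G' z \<i>)"
      unfolding G'_def by (intro continuous_intros cq basis)+
  qed
  have "0 \<le> laplacian z" for z
  proof (rule laplacian_nonneg_if_submean)
    fix r :: real assume "0 < r"
    then have "u (plane z) \<le> 1 / (2*pi) * integral {0..2*pi} (\<lambda>t. u (plane (z + of_real r * cis t)))"
      using sub unfolding subharmonic_def circle_point_plane[symmetric] by blast
    then show "2 * pi * (u \<circ> plane) z \<le> integral {0..2*pi} (\<lambda>\<theta>. (u \<circ> plane) (z + of_real r * cis \<theta>))"
      by (simp add: field_simps)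
  qed
  then have "subharmonic_C2 (u \<circ> plane) G G'" by unfold_locales
  then show ?thesis by (rule that)
qed

locale plane_metric = continuous_weight u + subharmonic_C2 "u \<circ> plane" G G'
  for u :: "real^2 \<Rightarrow> real" and G G'
begin

lemma circle_sup_eq: "circle_sup r u = max_on_circle r"
proof -
  have "u ` {z. norm z = r} = (u \<circ> plane) ` {z. norm z = r}"
  proof (intro equalityI subsetI)
    fix y assume "y \<in> u ` {z. norm z = r}"
    then obtain x where x: "y = u x" "norm x = r" by auto
    obtain z where "x = plane z" by (rule plane_surj)
    then show "y \<in> (u \<circ> plane) ` {z. norm z = r}" using x by auto
  qed auto
  then show ?thesis by (simp add: circle_sup_def max_on_circle_def)
qed

lemma log_growth_limit:
  shows "((\<lambda>r. ereal (max_on_circle r / ln r)) \<longlongrightarrow> log_growth u) at_top"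
    and "1 < r \<Longrightarrow> ereal ((max_on_circle r - max_on_circle 1) / ln r) \<le> log_growth u"
proof -
  obtain L where L: "((\<lambda>r. ereal (max_on_circle r / ln r)) \<longlongrightarrow> L) at_top"
    "\<And>r. 1 < r \<Longrightarrow> ereal ((max_on_circle r - max_on_circle 1) / ln r) \<le> L"
    using max_on_circle_growth by blast
  have "log_growth u = L"
    unfolding log_growth_def circle_sup_eq by (rule tendsto_Lim[OF _ L(1)]) simp
  then show "((\<lambda>r. ereal (max_on_circle r / ln r)) \<longlongrightarrow> log_growth u) at_top"
    "1 < r \<Longrightarrow> ereal ((max_on_circle r - max_on_circle 1) / ln r) \<le> log_growth u" using L by auto
qed

lemma complete_if_log_growth_le_1:
  assumes "log_growth u \<le> 1"
  shows mcomplete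
proof -
  have "compact (u ` cball 0 1)" by (intro compact_continuous_image continuous_on_subset[OF continuous]) auto
  then have "bounded (u ` cball 0 1)" by (rule compact_imp_bounded)
  then obtain M where "\<forall>v\<in>u ` cball 0 1. norm v \<le> M" unfolding bounded_iff by blast
  then have M: "u x \<le> M" if "norm x \<le> 1" for x using that by force
  define C where "C = max M (max_on_circle 1)"
  have up: "u x \<le> C + ln (sqrt (1 + x \<bullet> x))" for x
  proof (cases "norm x \<le> 1")
    case True
    have "0 \<le> ln (sqrt (1 + x \<bullet> x))" by (intro ln_ge_zero) simp
    moreover have "M \<le> C" by (simp add: C_def)
    ultimately show ?thesis using M[OF True] by linarith
  next
    case False
    obtain z where z: "x = plane z" by (rule plane_surj)
    define r where "r = norm z"
    have r: "1 < r" using False by (simp add: r_def z)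
    have "ereal ((max_on_circle r - max_on_circle 1) / ln r) \<le> ereal 1"
      by (rule order_trans[OF log_growth_limit(2)[OF r]]) (use assms in \<open>simp add: one_ereal_def\<close>)
    then have "max_on_circle r \<le> max_on_circle 1 + ln r" using ln_gt_zero[OF r] by (simp add: field_simps)
    moreover have "u x \<le> max_on_circle r" using le_max_on_circle[of z] by (simp add: z r_def)
    moreover have "norm x \<le> sqrt (1 + x \<bullet> x)" unfolding norm_eq_sqrt_inner by simp
    then have "r \<le> sqrt (1 + x \<bullet> x)" by (simp add: r_def z)
    then have "ln r \<le> ln (sqrt (1 + x \<bullet> x))" using r by (intro ln_mono) auto
    ultimately show ?thesis by (simp add: C_def)
  qed
  show ?thesis
  proof (rule mcomplete_if_log_growth)
    fix x :: "real^2"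
    have p: "0 < sqrt (1 + x \<bullet> x)" by (simp add: add_pos_nonneg)
    have "exp (- (C + ln (sqrt (1 + x \<bullet> x)))) \<le> exp (- u x)" using up[of x] by simp
    then show "exp (- C) / sqrt (1 + x \<bullet> x) \<le> exp (- u x)"
      by (simp only: minus_add_distrib exp_add exp_minus[of "ln _"] exp_ln[OF p] divide_inverse)
  qed simp
qed

text \<open>
  The set \<open>K\<close> is the ball of radius 2 about \<open>w\<close>. It avoids the closed unit disc when \<open>w\<close> is further from 0 than
  any point of that disc, by more than 2; and this holds for \<open>|w| > R\<close> because balls are bounded.
\<close>

lemma log_growth_le_1_if_complete:
  assumes mcomplete
  shows "log_growth u \<le> 1"
proof -
  note bd = mcomplete_imp_bounded_ball[OF assms]
  have "compact (d 0 ` cball 0 1)" 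
    by (intro compact_continuous_image continuous_on_d[OF continuous_on_id, unfolded id_def] compact_cball)
  then have "bounded (d 0 ` cball 0 1)" by (rule compact_imp_bounded)
  then obtain c where "\<forall>v\<in>d 0 ` cball 0 1. norm v \<le> c" unfolding bounded_iff by blast
  then have c: "d 0 x \<le> c" if "norm x \<le> 1" for x using that by force
  obtain R where R: "\<And>x. d 0 x \<le> c + 2 \<Longrightarrow> norm x \<le> R" using bd[of 0 "c + 2"] unfolding bounded_iff by auto
  have bound: "log_density w \<le> ln 4" if w: "R < norm w" for w
  proof -
    define K where "K = {z. d (plane w) (plane z) \<le> 2}"
    obtain N0 where N0: "\<And>N z i. N0 \<le> N \<Longrightarrow> z 0 = plane w \<Longrightarrow>
     real N * (\<Sum>i<N. exp (- 2 * u (z i)) * (dist (z i) (z (Suc i)))\<^sup>2) < 1 \<Longrightarrow> i \<le> N \<Longrightarrow> d (plane w) (z i) \<le> 2"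
      using chains_confined[OF bd] by blast
    have "exp (log_density w) \<le> 4"
    proof (rule discrete_ahlfors)
      have "bounded K"
      proof -
        obtain B where "\<And>x. d (plane w) x \<le> 2 \<Longrightarrow> norm x \<le> B" using bd[of "plane w" 2] unfolding bounded_iff by auto
        then show ?thesis unfolding bounded_iff K_def by (metis mem_Collect_eq norm_plane)
      qed
      moreover have "closed K" unfolding K_def
        by (intro closed_Collect_le continuous_on_d linear_continuous_on[OF bounded_linear_plane] continuous_on_const)
      ultimately show "compact K" by (simp add: compact_eq_bounded_closed)
      show "1 < norm z" if "z \<in> K" for z
      proof (rule ccontr)
        assume "\<not> 1 < norm z"
        then have "d 0 (plane z) \<le> c" by (intro c) simp
        then have "d 0 (plane w) \<le> c + 2" using that d_triangle[of 0 "plane w" "plane z"] d_commute[of "plane w"] by (simp add: K_def)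
        then show False using R[of "plane w"] w by simp
      qed
      show "w \<in> K" by (simp add: K_def)
      show "z i \<in> K" if "N0 \<le> N" "z 0 = w" "energy N z < 1" "i \<le> N" for N z i
        using N0[of N "\<lambda>i. plane (z i)" i] that
        by (simp add: K_def energy_def weight_def dist_norm[where 'a=complex] norm_minus_commute)
    qed
    then show ?thesis by (simp add: ln_ge_iff)
  qed
  have ev: "\<forall>\<^sub>F r::real in at_top. ereal (max_on_circle r / ln r) \<le> ereal (1 + ln (ln r) / ln r + ln 4 / ln r)"
  proof (rule eventually_mono[OF eventually_gt_at_top[of "max R (exp 1)"]])
    fix r assume r: "max R (exp 1) < r"
    then have r1: "1 < r" using exp_gt_one[of 1] by linarith
    then have l: "0 < ln r" by (rule ln_gt_zero)
    have "max_on_circle r \<le> ln r + ln (ln r) + ln 4"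
    proof (rule max_on_circle_le)
      fix z :: complex assume z: "norm z = r"
      then show "(u \<circ> plane) z \<le> ln r + ln (ln r) + ln 4" using bound[of z] r by (simp add: log_density_def)
    qed (use r1 in simp)
    then have "max_on_circle r / ln r \<le> (ln r + ln (ln r) + ln 4) / ln r" using l by (intro divide_right_mono) auto
    then show "ereal (max_on_circle r / ln r) \<le> ereal (1 + ln (ln r) / ln r + ln 4 / ln r)"
      using l by (simp add: add_divide_distrib)
  qed
  have "((\<lambda>r::real. ln (ln r) / ln r) \<longlongrightarrow> 0) at_top"
    using filterlim_compose[OF ln_x_over_x_tendsto_0 ln_at_top] .
  moreover have "((\<lambda>r::real. ln 4 / ln r) \<longlongrightarrow> 0) at_top"
    by (intro real_tendsto_divide_at_top[OF tendsto_const] ln_at_top)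
  ultimately have "((\<lambda>r::real. 1 + ln (ln r) / ln r + ln 4 / ln r) \<longlongrightarrow> 1 + 0 + 0) at_top"
    by (intro tendsto_add tendsto_const)
  then have "((\<lambda>r::real. ereal (1 + ln (ln r) / ln r + ln 4 / ln r)) \<longlongrightarrow> ereal 1) at_top" by simp
  from tendsto_le[OF _ this log_growth_limit(1) ev] show ?thesis by (simp add: one_ereal_def)
qed

end

theorem theorem1p1:
  fixes u :: "real^2 \<Rightarrow> real"
  assumes "smooth_function u" and "subharmonic u"
  shows "riem_complete (conformal_metric (\<lambda>x. exp (- 2 * u x)) euclidean_riem_metric) \<longleftrightarrow>
           log_growth u \<le> 1"
proof -
  have "C_k_function 0 u" using assms(1) unfolding smooth_function_def by blast
  then interpret continuous_weight u by unfold_locales simp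
  obtain G G' where "subharmonic_C2 (u \<circ> plane) G G'" using subharmonic_C2_of_smooth[OF assms] .
  then interpret subharmonic_C2 "u \<circ> plane" G G' .
  interpret plane_metric u G G' by unfold_locales
  show ?thesis
    unfolding riem_complete_def exp_metric_def[symmetric] d_def[symmetric]
    using complete_if_log_growth_le_1 log_growth_le_1_if_complete by blast
qed

end
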